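(* Let $w$ be a nonconstant smooth solution of the generalized Obata equation $\nabla dw+f(w)g=0$ on a connected complete Riemannian manifold $(M,g)$ of dimension $n$, for a smooth function $f(s)$. Let $p_0$ be a critical point of $w$ and set $\mu=w(p_0)$. Let $\gamma$ be a unit speed geodesic starting at $p_0$, and let $u$ be the solution of $u''+f(u)=0$, $u(0)=\mu$, $u'(0)=0$. Let $Y$ be a normal Jacobi field along $\gamma$ such that $Y(0)=0$, and let $V$ denote the parallel transport of $Y'(0)$ along $\gamma$. Then $$Y=-f(\mu)^{-1}u'\,V .$$
   Context: $\nabla dw$ is the Hessian of $w$; $f$ is smooth on an interval containing the image of $w$. Under these hypotheses $f(\mu)\ne0$, so the formula makes sense. *)

theory Defs
  imports "HOL-Analysis.Analysis"
begin

section \<open>Smoothness\<close>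

fun diff_order_on :: "nat \<Rightarrow> 'a::euclidean_space set \<Rightarrow> ('a \<Rightarrow> 'b::real_normed_vector) \<Rightarrow> bool"
  where
    "diff_order_on 0 S f \<longleftrightarrow> continuous_on S f"
  | "diff_order_on (Suc k) S f \<longleftrightarrow>
       (\<forall>x\<in>S. f differentiable (at x)) \<and>
       (\<forall>v. diff_order_on k S (\<lambda>x. frechet_derivative f (at x) v))"

text \<open>Meant for open \<open>S\<close>.\<close>

definition smooth_on :: "'a::euclidean_space set \<Rightarrow> ('a \<Rightarrow> 'b::real_normed_vector) \<Rightarrow> bool"
  where "smooth_on S f \<longleftrightarrow> (\<forall>k. diff_order_on k S f)"

fun iter_deriv :: "real set \<Rightarrow> nat \<Rightarrow> (real \<Rightarrow> 'b::real_normed_vector) \<Rightarrow> real \<Rightarrow> 'b"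
  where
    "iter_deriv I 0 f = f"
  | "iter_deriv I (Suc k) f = (\<lambda>t. vector_derivative (iter_deriv I k f) (at t within I))"

text \<open>Functions of one variable on a nondegenerate interval \<open>I\<close>, with one-sided derivatives at
  endpoints belonging to \<open>I\<close>. The set \<open>S\<close> is a relatively open subset of \<open>I\<close>, so derivatives
  within \<open>I\<close> at points of \<open>S\<close> only depend on \<open>f\<close> on \<open>S\<close>.\<close>

definition smooth_within :: "real set \<Rightarrow> real set \<Rightarrow> (real \<Rightarrow> 'b::real_normed_vector) \<Rightarrow> bool"
  where "smooth_within I S f \<longleftrightarrow>
    (\<forall>k. \<forall>t\<in>S. iter_deriv I k f differentiable (at t within I))"

definition proper_interval :: "real set \<Rightarrow> bool"
  where "proper_interval I \<longleftrightarrow> is_interval I \<and> (\<exists>a\<in>I. \<exists>b\<in>I. a < b)"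


section \<open>Smooth manifolds\<close>

text \<open>A chart is its domain together with the coordinate map (of which only the restriction to the
  domain matters). A tangent vector at \<open>p\<close> is the family of its component vectors in all charts
  of the atlas around \<open>p\<close>, transforming by the Jacobians of the coordinate changes; the value at
  all other charts is normalized to \<open>0\<close>, so that equality of tangent vectors is equality of
  functions.\<close>

type_synonym ('m, 'n) chart = "'m set \<times> ('m \<Rightarrow> real ^ 'n)"
type_synonym ('m, 'n) tvec = "('m, 'n) chart \<Rightarrow> real ^ 'n"

record ('m, 'n) riem =
  top_of :: "'m topology"
  atlas :: "('m, 'n::finite) chart set"
  metric :: "'m \<Rightarrow> ('m, 'n) tvec \<Rightarrow> ('m, 'n) tvec \<Rightarrow> real"

abbreviation pts :: "('m, 'n::finite) riem \<Rightarrow> 'm set"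
  where "pts M \<equiv> topspace (top_of M)"

abbreviation chart_inv :: "('m, 'n::finite) chart \<Rightarrow> real ^ 'n \<Rightarrow> 'm"
  where "chart_inv c \<equiv> inv_into (fst c) (snd c)"

definition charts_at :: "('m, 'n::finite) riem \<Rightarrow> 'm \<Rightarrow> ('m, 'n) chart set"
  where "charts_at M p = {c \<in> atlas M. p \<in> fst c}"

definition smooth_manifold :: "('m, 'n::finite) riem \<Rightarrow> bool"
  where "smooth_manifold M \<longleftrightarrow>
    Hausdorff_space (top_of M) \<and> second_countable (top_of M) \<and>
    pts M = (\<Union>c\<in>atlas M. fst c) \<and>
    (\<forall>c\<in>atlas M. openin (top_of M) (fst c) \<and> open (snd c ` fst c) \<and>
       homeomorphic_map (subtopology (top_of M) (fst c)) (top_of_set (snd c ` fst c)) (snd c)) \<and>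
    (\<forall>c\<in>atlas M. \<forall>d\<in>atlas M. smooth_on (snd c ` (fst c \<inter> fst d)) (snd d \<circ> chart_inv c))"

definition coord_change_deriv ::
    "('m, 'n::finite) chart \<Rightarrow> ('m, 'n) chart \<Rightarrow> 'm \<Rightarrow> real ^ 'n \<Rightarrow> real ^ 'n"
  where "coord_change_deriv c d p = frechet_derivative (snd d \<circ> chart_inv c) (at (snd c p))"

definition tangent_space :: "('m, 'n::finite) riem \<Rightarrow> 'm \<Rightarrow> ('m, 'n) tvec set"
  where "tangent_space M p =
    {X. (\<forall>c\<in>charts_at M p. \<forall>d\<in>charts_at M p. X d = coord_change_deriv c d p (X c)) \<and>
        (\<forall>c. c \<notin> charts_at M p \<longrightarrow> X c = 0)}"

definition coord_vec :: "('m, 'n::finite) riem \<Rightarrow> ('m, 'n) chart \<Rightarrow> 'm \<Rightarrow> 'n \<Rightarrow> ('m, 'n) tvec"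
  where "coord_vec M c p i =
    (\<lambda>d. if d \<in> charts_at M p then coord_change_deriv c d p (axis i 1) else 0)"

definition smooth_fun :: "('m, 'n::finite) riem \<Rightarrow> ('m \<Rightarrow> real) \<Rightarrow> bool"
  where "smooth_fun M w \<longleftrightarrow> (\<forall>c\<in>atlas M. smooth_on (snd c ` fst c) (w \<circ> chart_inv c))"

definition critical_point :: "('m, 'n::finite) riem \<Rightarrow> ('m \<Rightarrow> real) \<Rightarrow> 'm \<Rightarrow> bool"
  where "critical_point M w p \<longleftrightarrow>
    p \<in> pts M \<and>
    (\<forall>c\<in>charts_at M p. frechet_derivative (w \<circ> chart_inv c) (at (snd c p)) = (\<lambda>_. 0))"


section \<open>Riemannian metrics, Levi-Civita connection, Hessian and curvature\<close>

definition pderiv_at :: "'n::finite \<Rightarrow> (real ^ 'n \<Rightarrow> real) \<Rightarrow> real ^ 'n \<Rightarrow> real"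
  where "pderiv_at i F x = frechet_derivative F (at x) (axis i 1)"

definition metric_coeff ::
    "('m, 'n::finite) riem \<Rightarrow> ('m, 'n) chart \<Rightarrow> 'n \<Rightarrow> 'n \<Rightarrow> real ^ 'n \<Rightarrow> real"
  where "metric_coeff M c i j x =
    metric M (chart_inv c x) (coord_vec M c (chart_inv c x) i) (coord_vec M c (chart_inv c x) j)"

definition riemannian_manifold :: "('m, 'n::finite) riem \<Rightarrow> bool"
  where "riemannian_manifold M \<longleftrightarrow>
    smooth_manifold M \<and>
    (\<forall>p\<in>pts M. \<forall>X\<in>tangent_space M p. \<forall>Y\<in>tangent_space M p.
       metric M p X Y = metric M p Y X) \<and>
    (\<forall>p\<in>pts M. \<forall>X\<in>tangent_space M p. \<forall>Y\<in>tangent_space M p. \<forall>Z\<in>tangent_space M p. \<forall>a b.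
       metric M p (\<lambda>c. a *\<^sub>R X c + b *\<^sub>R Y c) Z = a * metric M p X Z + b * metric M p Y Z) \<and>
    (\<forall>p\<in>pts M. \<forall>X\<in>tangent_space M p. X \<noteq> (\<lambda>_. 0) \<longrightarrow> metric M p X X > 0) \<and>
    (\<forall>c\<in>atlas M. \<forall>i j. smooth_on (snd c ` fst c) (metric_coeff M c i j))"

definition inverse_metric_coeff ::
    "('m, 'n::finite) riem \<Rightarrow> ('m, 'n) chart \<Rightarrow> 'n \<Rightarrow> 'n \<Rightarrow> real ^ 'n \<Rightarrow> real"
  where "inverse_metric_coeff M c i j x = matrix_inv (\<chi> k l. metric_coeff M c k l x) $ i $ j"

text \<open>\<open>christoffel M c k i j\<close> is \<open>\<Gamma>\<close> with upper index \<open>k\<close> and lower indices \<open>i\<close>, \<open>j\<close>.\<close>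

definition christoffel ::
    "('m, 'n::finite) riem \<Rightarrow> ('m, 'n) chart \<Rightarrow> 'n \<Rightarrow> 'n \<Rightarrow> 'n \<Rightarrow> real ^ 'n \<Rightarrow> real"
  where "christoffel M c k i j x =
    (\<Sum>l\<in>UNIV. inverse_metric_coeff M c k l x *
       (pderiv_at i (metric_coeff M c j l) x + pderiv_at j (metric_coeff M c i l) x
         - pderiv_at l (metric_coeff M c i j) x)) / 2"

definition hessian_coeff ::
    "('m, 'n::finite) riem \<Rightarrow> ('m \<Rightarrow> real) \<Rightarrow> ('m, 'n) chart \<Rightarrow> 'n \<Rightarrow> 'n \<Rightarrow> real ^ 'n \<Rightarrow> real"
  where "hessian_coeff M w c i j x =
    pderiv_at i (pderiv_at j (w \<circ> chart_inv c)) x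
      - (\<Sum>k\<in>UNIV. christoffel M c k i j x * pderiv_at k (w \<circ> chart_inv c) x)"

text \<open>The value \<open>(\<nabla>dw)(X, Y)\<close> at \<open>p\<close>, computed in the chart \<open>c\<close>.\<close>

definition hessian ::
    "('m, 'n::finite) riem \<Rightarrow> ('m \<Rightarrow> real) \<Rightarrow> ('m, 'n) chart \<Rightarrow> 'm \<Rightarrow>
      ('m, 'n) tvec \<Rightarrow> ('m, 'n) tvec \<Rightarrow> real"
  where "hessian M w c p X Y =
    (\<Sum>i\<in>UNIV. \<Sum>j\<in>UNIV. hessian_coeff M w c i j (snd c p) * X c $ i * Y c $ j)"

definition obata_solution ::
    "('m, 'n::finite) riem \<Rightarrow> (real \<Rightarrow> real) \<Rightarrow> ('m \<Rightarrow> real) \<Rightarrow> bool"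
  where "obata_solution M f w \<longleftrightarrow>
    smooth_fun M w \<and>
    (\<forall>p\<in>pts M. \<forall>c\<in>charts_at M p. \<forall>X\<in>tangent_space M p. \<forall>Y\<in>tangent_space M p.
       hessian M w c p X Y + f (w p) * metric M p X Y = 0)"

text \<open>Sign convention \<open>R(X,Y)Z = \<nabla>\<^sub>X\<nabla>\<^sub>YZ - \<nabla>\<^sub>Y\<nabla>\<^sub>XZ - \<nabla>\<^sub>[\<^sub>X\<^sub>,\<^sub>Y\<^sub>]Z\<close>; \<open>curvature_coeff M c l k i j\<close> is the
  \<open>l\<close>-th component of \<open>R(\<partial>\<^sub>i, \<partial>\<^sub>j)\<partial>\<^sub>k\<close>.\<close>

definition curvature_coeff ::
    "('m, 'n::finite) riem \<Rightarrow> ('m, 'n) chart \<Rightarrow> 'n \<Rightarrow> 'n \<Rightarrow> 'n \<Rightarrow> 'n \<Rightarrow> real ^ 'n \<Rightarrow> real"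
  where "curvature_coeff M c l k i j x =
    pderiv_at i (christoffel M c l j k) x - pderiv_at j (christoffel M c l i k) x
      + (\<Sum>m\<in>UNIV. christoffel M c l i m x * christoffel M c m j k x
                 - christoffel M c l j m x * christoffel M c m i k x)"

definition curvature ::
    "('m, 'n::finite) riem \<Rightarrow> 'm \<Rightarrow> ('m, 'n) tvec \<Rightarrow> ('m, 'n) tvec \<Rightarrow> ('m, 'n) tvec \<Rightarrow> ('m, 'n) tvec"
  where "curvature M p X Y Z = (\<lambda>c. if c \<in> charts_at M p
    then (\<chi> l. \<Sum>i\<in>UNIV. \<Sum>j\<in>UNIV. \<Sum>k\<in>UNIV.
           curvature_coeff M c l k i j (snd c p) * X c $ i * Y c $ j * Z c $ k)
    else 0)"


section \<open>Curves, geodesics, parallel and Jacobi fields\<close>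

definition smooth_curve :: "('m, 'n::finite) riem \<Rightarrow> real set \<Rightarrow> (real \<Rightarrow> 'm) \<Rightarrow> bool"
  where "smooth_curve M I \<gamma> \<longleftrightarrow>
    continuous_map (top_of_set I) (top_of M) \<gamma> \<and>
    (\<forall>c\<in>atlas M. smooth_within I {t\<in>I. \<gamma> t \<in> fst c} (snd c \<circ> \<gamma>))"

definition velocity ::
    "('m, 'n::finite) riem \<Rightarrow> real set \<Rightarrow> (real \<Rightarrow> 'm) \<Rightarrow> real \<Rightarrow> ('m, 'n) tvec"
  where "velocity M I \<gamma> t = (\<lambda>c. if c \<in> charts_at M (\<gamma> t)
    then vector_derivative (snd c \<circ> \<gamma>) (at t within I) else 0)"

definition field_along ::
    "('m, 'n::finite) riem \<Rightarrow> real set \<Rightarrow> (real \<Rightarrow> 'm) \<Rightarrow> (real \<Rightarrow> ('m, 'n) tvec) \<Rightarrow> bool"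
  where "field_along M I \<gamma> X \<longleftrightarrow>
    (\<forall>t\<in>I. X t \<in> tangent_space M (\<gamma> t)) \<and>
    (\<forall>c\<in>atlas M. smooth_within I {t\<in>I. \<gamma> t \<in> fst c} (\<lambda>t. X t c))"

definition cov_deriv ::
    "('m, 'n::finite) riem \<Rightarrow> real set \<Rightarrow> (real \<Rightarrow> 'm) \<Rightarrow> (real \<Rightarrow> ('m, 'n) tvec) \<Rightarrow>
      real \<Rightarrow> ('m, 'n) tvec"
  where "cov_deriv M I \<gamma> X t = (\<lambda>c. if c \<in> charts_at M (\<gamma> t)
    then vector_derivative (\<lambda>s. X s c) (at t within I)
      + (\<chi> k. \<Sum>i\<in>UNIV. \<Sum>j\<in>UNIV.
           christoffel M c k i j (snd c (\<gamma> t)) * velocity M I \<gamma> t c $ i * X t c $ j)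
    else 0)"

definition parallel_along ::
    "('m, 'n::finite) riem \<Rightarrow> real set \<Rightarrow> (real \<Rightarrow> 'm) \<Rightarrow> (real \<Rightarrow> ('m, 'n) tvec) \<Rightarrow> bool"
  where "parallel_along M I \<gamma> X \<longleftrightarrow>
    field_along M I \<gamma> X \<and> (\<forall>t\<in>I. cov_deriv M I \<gamma> X t = (\<lambda>_. 0))"

definition geodesic :: "('m, 'n::finite) riem \<Rightarrow> real set \<Rightarrow> (real \<Rightarrow> 'm) \<Rightarrow> bool"
  where "geodesic M I \<gamma> \<longleftrightarrow>
    smooth_curve M I \<gamma> \<and> (\<forall>t\<in>I. cov_deriv M I \<gamma> (velocity M I \<gamma>) t = (\<lambda>_. 0))"

definition unit_speed :: "('m, 'n::finite) riem \<Rightarrow> real set \<Rightarrow> (real \<Rightarrow> 'm) \<Rightarrow> bool"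
  where "unit_speed M I \<gamma> \<longleftrightarrow>
    (\<forall>t\<in>I. metric M (\<gamma> t) (velocity M I \<gamma> t) (velocity M I \<gamma> t) = 1)"

definition jacobi_field ::
    "('m, 'n::finite) riem \<Rightarrow> real set \<Rightarrow> (real \<Rightarrow> 'm) \<Rightarrow> (real \<Rightarrow> ('m, 'n) tvec) \<Rightarrow> bool"
  where "jacobi_field M I \<gamma> X \<longleftrightarrow>
    field_along M I \<gamma> X \<and>
    (\<forall>t\<in>I. \<forall>c. cov_deriv M I \<gamma> (cov_deriv M I \<gamma> X) t c
       + curvature M (\<gamma> t) (X t) (velocity M I \<gamma> t) (velocity M I \<gamma> t) c = 0)"

definition normal_along ::
    "('m, 'n::finite) riem \<Rightarrow> real set \<Rightarrow> (real \<Rightarrow> 'm) \<Rightarrow> (real \<Rightarrow> ('m, 'n) tvec) \<Rightarrow> bool"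
  where "normal_along M I \<gamma> X \<longleftrightarrow> (\<forall>t\<in>I. metric M (\<gamma> t) (X t) (velocity M I \<gamma> t) = 0)"

text \<open>Completeness in the sense of geodesics: every geodesic extends to the whole real line.\<close>

definition complete_manifold :: "('m, 'n::finite) riem \<Rightarrow> bool"
  where "complete_manifold M \<longleftrightarrow>
    (\<forall>p\<in>pts M. \<forall>v\<in>tangent_space M p. \<exists>\<sigma>.
       geodesic M UNIV \<sigma> \<and> \<sigma> 0 = p \<and> velocity M UNIV \<sigma> 0 = v)"

end

theory Submission
  imports Defs
begin

text \<open>
  Write \<open>W\<close> for the gradient of \<open>w\<close>. The Obata equation says \<open>\<nabla>\<^sub>X W = - f(w) X\<close>. Along the unit speed
  geodesic \<open>\<gamma>\<close> this gives \<open>(w \<circ> \<gamma>)'' = - f(w \<circ> \<gamma>)\<close>, so \<open>w \<circ> \<gamma>\<close> and \<open>u\<close> solve the same initial value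
  problem and agree. The fields \<open>W\<close> and \<open>u' \<gamma>'\<close> along \<open>\<gamma>\<close> both have covariant derivative
  \<open>- f(u) \<gamma>'\<close> and both vanish at \<open>p\<^sub>0\<close>; hence \<open>W = u' \<gamma>'\<close> (lemma \<open>gradient_along\<close>).

  Differentiating \<open>\<nabla>\<^sub>X W = - f(w) X\<close> once more and antisymmetrising yields
  \<open>R(X, Z) W = f'(w) (dw(Z) X - dw(X) Z)\<close> (lemma \<open>curvature_gradient\<close>). For \<open>Z = \<gamma>'\<close> and
  \<open>X \<perp> \<gamma>'\<close> this reads \<open>u' R(X, \<gamma>') \<gamma>' = u' f'(u) X\<close>. So wherever \<open>u' \<noteq> 0\<close> the normal Jacobi field
  satisfies \<open>Y'' + f'(u) Y = 0\<close>. The field \<open>u' V\<close> satisfies the same linear equation because \<open>V\<close> is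
  parallel and \<open>u''' = - f'(u) u'\<close>. Multiplied by \<open>- 1 / f(\<mu>)\<close> it also has the initial values of
  \<open>Y\<close>, since \<open>u''(0) = - f(\<mu>)\<close>. Uniqueness for linear differential equations finishes the proof.

  Two nondegeneracy facts enter. First, \<open>f(\<mu>) \<noteq> 0\<close>: otherwise the pair of the constant \<open>\<mu>\<close> and the
  zero covector solves the first order system that the Obata equation imposes on \<open>(w, dw)\<close> along every
  segment in a chart. Then the set of critical points with value \<open>\<mu>\<close> is open and closed, and \<open>w\<close> would
  be constant (lemma \<open>obata_critical_value_nondegenerate\<close>). Second, zeros of \<open>u'\<close> are
  isolated: \<open>u' = f(u) = 0\<close> at one point would make \<open>u\<close> constant and force \<open>f(\<mu>) = 0\<close>. The uniqueness
  lemma for differential inequalities is therefore stated with one exceptional point.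

  All computations are done in charts. Each uniqueness statement is a local one inside a chart, and the
  connectedness of the interval (or of the manifold) passes it from chart to chart.
\<close>

section \<open>Uniqueness for differential inequalities\<close>

text \<open>A Gronwall argument: \<open>\<parallel>Z\<parallel>\<^sup>2 exp (-2 K t)\<close> is nonincreasing and \<open>\<parallel>Z\<parallel>\<^sup>2 exp (2 K t)\<close> is
  nondecreasing, so a zero spreads forwards and backwards. Only interior derivatives are used, which
  leaves the endpoints free to be points where the equation is not available.\<close>

lemma norm_bounded_derivative_imp_zero_on_segment:
  fixes Z :: "real \<Rightarrow> 'a::real_inner"
  assumes cont: "continuous_on {a..b} Z"
    and der: "\<And>t. a < t \<Longrightarrow> t < b \<Longrightarrow> (Z has_vector_derivative Z' t) (at t)"
    and bd: "\<And>t. a < t \<Longrightarrow> t < b \<Longrightarrow> norm (Z' t) \<le> K * norm (Z t)"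
    and zero: "Z a = 0 \<or> Z b = 0" and t: "t \<in> {a..b}"
  shows "Z t = 0"
proof -
  \<comment> \<open>\<open>\<sigma> = -1\<close> propagates a zero at \<open>a\<close> to the right, \<open>\<sigma> = 1\<close> a zero at \<open>b\<close> to the left.\<close>
  define H where "H \<sigma> s = (Z s \<bullet> Z s) * exp (\<sigma> * (2 * K * s))" for \<sigma> s :: real
  have cH: "continuous_on {a..b} (H \<sigma>)" for \<sigma>
    unfolding H_def by (intro continuous_intros cont)
  have dH: "(H \<sigma> has_real_derivative (2 * (Z s \<bullet> Z' s) + \<sigma> * (2 * K) * (Z s \<bullet> Z s)) * exp (\<sigma> * (2 * K * s))) (at s)"
    if "a < s" "s < b" for \<sigma> s
  proof -
    have "((\<lambda>s. Z s \<bullet> Z s) has_real_derivative (2 * (Z s \<bullet> Z' s))) (at s)"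
      using has_derivative_inner[OF der[OF that, unfolded has_vector_derivative_def] der[OF that, unfolded has_vector_derivative_def]]
      unfolding has_field_derivative_def
      by (rule has_derivative_eq_rhs) (auto simp: inner_commute algebra_simps)
    then show ?thesis
      unfolding H_def by (auto intro!: derivative_eq_intros simp: algebra_simps)
  qed
  have ip: "\<bar>2 * (Z s \<bullet> Z' s)\<bar> \<le> 2 * K * (Z s \<bullet> Z s)" if "a < s" "s < b" for s
  proof -
    have "\<bar>Z s \<bullet> Z' s\<bar> \<le> norm (Z s) * norm (Z' s)"
      by (rule Cauchy_Schwarz_ineq2)
    also have "\<dots> \<le> norm (Z s) * (K * norm (Z s))"
      using bd[OF that] by (intro mult_left_mono) auto
    also have "\<dots> = K * (Z s \<bullet> Z s)"
      by (simp add: dot_square_norm power2_eq_square)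
    finally show ?thesis by simp
  qed
  have mvt: "\<exists>z. r < z \<and> z < s \<and> H \<sigma> s - H \<sigma> r =
      (s - r) * ((2 * (Z z \<bullet> Z' z) + \<sigma> * (2 * K) * (Z z \<bullet> Z z)) * exp (\<sigma> * (2 * K * z)))"
    if "a \<le> r" "r < s" "s \<le> b" for r s \<sigma>
  proof -
    have "continuous_on {r..s} (H \<sigma>)"
      using cH by (rule continuous_on_subset) (use that in auto)
    moreover have "H \<sigma> differentiable (at z)" if "r < z" "z < s" for z
      using dH[of z \<sigma>] that \<open>a \<le> r\<close> \<open>s \<le> b\<close> by (auto simp: real_differentiable_def)
    ultimately obtain l z where z: "r < z" "z < s" "DERIV (H \<sigma>) z :> l" "H \<sigma> s - H \<sigma> r = (s - r) * l"
      using MVT[OF \<open>r < s\<close>, of "H \<sigma>"] by blast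
    have "l = (2 * (Z z \<bullet> Z' z) + \<sigma> * (2 * K) * (Z z \<bullet> Z z)) * exp (\<sigma> * (2 * K * z))"
      by (rule DERIV_unique[OF z(3) dH]) (use z that in auto)
    with z show ?thesis by blast
  qed
  have "H 0 t = 0"
  proof (cases "Z t = 0")
    case True then show ?thesis by (simp add: H_def)
  next
    case nz: False
    have pos: "H \<sigma> t > 0" for \<sigma> using nz by (simp add: H_def)
    from zero show ?thesis
    proof
      assume za: "Z a = 0"
      then have "a < t" using nz t by (cases "a = t") auto
      then obtain z where z: "a < z" "z < t" "H (-1) t - H (-1) a =
          (t - a) * ((2 * (Z z \<bullet> Z' z) + (-1) * (2 * K) * (Z z \<bullet> Z z)) * exp ((-1) * (2 * K * z)))"
        using mvt[of a t "-1"] t by auto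
      have "2 * (Z z \<bullet> Z' z) + (-1) * (2 * K) * (Z z \<bullet> Z z) \<le> 0"
        using ip[of z] z t by auto
      then have "H (-1) t - H (-1) a \<le> 0"
        unfolding z(3) using \<open>a < t\<close> by (intro mult_nonneg_nonpos mult_nonpos_nonneg) auto
      moreover have "H (-1) a = 0" using za by (simp add: H_def)
      ultimately show ?thesis using pos[of "-1"] by simp
    next
      assume zb: "Z b = 0"
      then have "t < b" using nz t by (cases "t = b") auto
      then obtain z where z: "t < z" "z < b" "H 1 b - H 1 t =
          (b - t) * ((2 * (Z z \<bullet> Z' z) + 1 * (2 * K) * (Z z \<bullet> Z z)) * exp (1 * (2 * K * z)))"
        using mvt[of t b 1] t by auto
      have "2 * (Z z \<bullet> Z' z) + 1 * (2 * K) * (Z z \<bullet> Z z) \<ge> 0"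
        using ip[of z] z t by auto
      then have "H 1 b - H 1 t \<ge> 0"
        unfolding z(3) using \<open>t < b\<close> by (intro mult_nonneg_nonneg) auto
      moreover have "H 1 b = 0" using zb by (simp add: H_def)
      ultimately show ?thesis using pos[of 1] by simp
    qed
  qed
  then show ?thesis by (simp add: H_def)
qed

text \<open>The exceptional point \<open>e\<close> is reached as an endpoint of a segment: the zero travels from \<open>s\<close> to
  \<open>e\<close> and then from \<open>e\<close> to \<open>r\<close>.\<close>

lemma norm_bounded_derivative_imp_zero:
  fixes Z :: "real \<Rightarrow> 'a::real_inner"
  assumes I: "is_interval I" and cont: "continuous_on I Z"
    and der: "\<And>t. t \<in> I \<Longrightarrow> t \<noteq> e \<Longrightarrow> (Z has_vector_derivative Z' t) (at t within I)"
    and bd: "\<And>t. t \<in> I \<Longrightarrow> t \<noteq> e \<Longrightarrow> norm (Z' t) \<le> K * norm (Z t)"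
    and e: "e \<in> I" and s: "s \<in> I" "Z s = 0" and r: "r \<in> I"
  shows "Z r = 0"
proof -
  have seg: "Z b = 0" if "a \<in> I" "b \<in> I" "Z a = 0" "a = e \<or> b = e" for a b
  proof -
    define l m where "l = min a b" and "m = max a b"
    have sub: "{l..m} \<subseteq> I"
      using mem_is_interval_1_I[OF I, of l m] that by (auto simp: l_def m_def min_def max_def)
    have ne: "t \<noteq> e" if "l < t" "t < m" for t
      using \<open>a = e \<or> b = e\<close> that by (auto simp: l_def m_def min_def max_def split: if_splits)
    show ?thesis
    proof (rule norm_bounded_derivative_imp_zero_on_segment[of l m Z Z' K b])
      show "continuous_on {l..m} Z" using cont sub by (rule continuous_on_subset)
      show "Z l = 0 \<or> Z m = 0" using \<open>Z a = 0\<close> by (auto simp: l_def m_def min_def max_def)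
      show "b \<in> {l..m}" by (auto simp: l_def m_def)
    next
      fix t assume t: "l < t" "t < m"
      then have tI: "t \<in> I" using sub by auto
      then show "norm (Z' t) \<le> K * norm (Z t)" using bd ne t by blast
      have "(Z has_vector_derivative Z' t) (at t within {l..m})"
        using der[OF tI ne[OF t]] sub by (rule has_vector_derivative_within_subset)
      then show "(Z has_vector_derivative Z' t) (at t)"
        using t at_within_Icc_at by metis
    qed
  qed
  from seg[OF s(1) e s(2)] have "Z e = 0" by simp
  from seg[OF e r this] show ?thesis by simp
qed

text \<open>With a coefficient bound that is merely continuous at \<open>t\<close>, the conclusion is local. In this
  form it combines with an induction over a connected interval whose local pieces lie in different
  charts.\<close>

lemma zero_propagates_locally:
  fixes Z :: "real \<Rightarrow> 'a::real_inner"
  assumes I: "is_interval I" and tI: "t \<in> I"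
    and T: "openin (top_of_set I) T" "t \<in> T"
    and cZ: "continuous_on T Z"
    and dZ: "\<And>s. s \<in> T \<Longrightarrow> s \<noteq> t \<Longrightarrow> (Z has_vector_derivative Z' s) (at s within I)"
    and bZ: "\<And>s. s \<in> T \<Longrightarrow> s \<noteq> t \<Longrightarrow> norm (Z' s) \<le> K s * norm (Z s)"
    and cK: "continuous (at t within I) K"
  shows "\<exists>N. openin (top_of_set I) N \<and> t \<in> N \<and> N \<subseteq> T \<and> (\<forall>a\<in>N. \<forall>b\<in>N. Z a = 0 \<longrightarrow> Z b = 0)"
proof -
  have TI: "T \<subseteq> I" using T openin_imp_subset by blast
  from T TI obtain d1 where d1: "d1 > 0" "\<And>s. s \<in> I \<Longrightarrow> dist s t < d1 \<Longrightarrow> s \<in> T"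
    unfolding openin_euclidean_subtopology_iff by blast
  from cK obtain d2 where d2: "d2 > 0" "\<And>s. s \<in> I \<Longrightarrow> dist s t < d2 \<Longrightarrow> dist (K s) (K t) < 1"
    unfolding continuous_within_eps_delta using zero_less_one[where 'a=real] by blast
  define d where "d = min d1 d2"
  define N where "N = I \<inter> ball t d"
  have NT: "N \<subseteq> T" using d1 by (auto simp: N_def d_def dist_commute)
  have "Z s = 0" if "a \<in> N" "s \<in> N" "Z a = 0" for a s
  proof (rule norm_bounded_derivative_imp_zero[of N Z t Z' "K t + 1" a s])
    show "is_interval N"
      unfolding N_def using I by (intro is_interval_Int) (auto simp: is_interval_ball_real)
    show "continuous_on N Z" using cZ NT by (rule continuous_on_subset)
    show "t \<in> N" using tI d1 d2 by (auto simp: N_def d_def)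
  next
    fix r assume r: "r \<in> N" "r \<noteq> t"
    then have "r \<in> T" using NT by auto
    have "(Z has_vector_derivative Z' r) (at r within I)" using dZ \<open>r \<in> T\<close> r(2) by blast
    then show "(Z has_vector_derivative Z' r) (at r within N)"
      by (rule has_vector_derivative_within_subset) (auto simp: N_def)
    have "K r \<le> K t + 1"
      using d2(2)[of r] r by (auto simp: N_def d_def dist_real_def dist_commute abs_diff_less_iff)
    then show "norm (Z' r) \<le> (K t + 1) * norm (Z r)"
      using bZ[OF \<open>r \<in> T\<close> r(2)] by (meson mult_right_mono norm_ge_zero order_trans)
  qed (use that in auto)
  moreover have "openin (top_of_set I) N" unfolding N_def by (simp add: openin_open_Int)
  moreover have "t \<in> N" using tI d1(1) d2(1) by (simp add: N_def d_def)
  ultimately show ?thesis using NT by blast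
qed

section \<open>Symmetry of second derivatives\<close>

text \<open>The mean value theorem in the direction \<open>u\<close> turns the second difference into a difference of
  values of \<open>f' \<cdot> u\<close> at two points that differ by \<open>t v\<close>; differentiability of \<open>f' \<cdot> u\<close> at the single
  point \<open>x\<close> suffices to evaluate it.\<close>

lemma second_difference_tendsto:
  fixes f :: "'a::real_normed_vector \<Rightarrow> real"
  assumes U: "open U" "x \<in> U"
    and f: "\<And>y. y \<in> U \<Longrightarrow> (f has_derivative f' y) (at y)"
    and P: "((\<lambda>y. f' y u) has_derivative P) (at x)"
  shows "((\<lambda>t. (f (x + t *\<^sub>R u + t *\<^sub>R v) - f (x + t *\<^sub>R u) - f (x + t *\<^sub>R v) + f x) / t\<^sup>2)
     \<longlongrightarrow> P v) (at_right 0)"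
proof (rule tendstoI)
  fix e :: real assume e: "e > 0"
  define N where "N = norm u + norm v + 1"
  have N: "N > 0" by (simp add: N_def add_nonneg_pos)
  define e' where "e' = e / (3 * N)"
  have e': "e' > 0" using e N by (simp add: e'_def)
  obtain d1 where d1: "d1 > 0" "\<And>y. norm (y - x) < d1 \<Longrightarrow>
      norm (f' y u - f' x u - P (y - x)) \<le> e' * norm (y - x)"
    using P e' unfolding has_derivative_at_alt by blast
  obtain d2 where d2: "d2 > 0" "ball x d2 \<subseteq> U" using U openE by blast
  have bl: "bounded_linear P" using P has_derivative_bounded_linear by blast
  define d where "d = min d1 d2 / N"
  have d: "d > 0" using d1 d2 N by (simp add: d_def)
  have near: "norm (s *\<^sub>R u + r *\<^sub>R v) \<le> t * N" "t * N < d1" "t * N < d2"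
    if "0 \<le> s" "s \<le> t" "0 \<le> r" "r \<le> t" "t < d" for s r t
  proof -
    have "norm (s *\<^sub>R u + r *\<^sub>R v) \<le> s * norm u + r * norm v"
      using norm_triangle_ineq[of "s *\<^sub>R u" "r *\<^sub>R v"] that by simp
    also have "\<dots> \<le> t * norm u + t * norm v"
      using that by (intro add_mono mult_right_mono) auto
    also have "\<dots> \<le> t * N" using that by (simp add: N_def algebra_simps)
    finally show "norm (s *\<^sub>R u + r *\<^sub>R v) \<le> t * N" .
    have "t * N < min d1 d2" using \<open>t < d\<close> N by (simp add: d_def field_simps)
    then show "t * N < d1" "t * N < d2" by auto
  qed
  have "\<bar>(f (x + t *\<^sub>R u + t *\<^sub>R v) - f (x + t *\<^sub>R u) - f (x + t *\<^sub>R v) + f x) / t\<^sup>2 - P v\<bar> < e"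
    if t: "0 < t" "t < d" for t
  proof -
    define h where "h s = f (x + s *\<^sub>R u + t *\<^sub>R v) - f (x + s *\<^sub>R u)" for s
    have inU: "x + s *\<^sub>R u + r *\<^sub>R v \<in> U" if "0 \<le> s" "s \<le> t" "0 \<le> r" "r \<le> t" for s r
      using near[OF that t(2)] d2(2) by (auto simp: dist_norm algebra_simps norm_minus_commute subset_eq)
    have inU0: "x + s *\<^sub>R u \<in> U" if "0 \<le> s" "s \<le> t" for s
      using inU[of s 0] that t by simp
    have dh: "(h has_real_derivative f' (x + s *\<^sub>R u + t *\<^sub>R v) u - f' (x + s *\<^sub>R u) u) (at s)"
      if s: "0 \<le> s" "s \<le> t" for s
    proof -
      have l: "((\<lambda>s. x + s *\<^sub>R u + t *\<^sub>R v) has_derivative (\<lambda>k. k *\<^sub>R u)) (at s)"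
        "((\<lambda>s. x + s *\<^sub>R u) has_derivative (\<lambda>k. k *\<^sub>R u)) (at s)"
        by (auto intro!: derivative_eq_intros)
      have f1: "(f has_derivative f' (x + s *\<^sub>R u + t *\<^sub>R v)) (at (x + s *\<^sub>R u + t *\<^sub>R v))"
        and f2: "(f has_derivative f' (x + s *\<^sub>R u)) (at (x + s *\<^sub>R u))"
        using inU[OF s] inU0[OF s] t by (auto intro!: f)
      note lin = bounded_linear.linear[OF has_derivative_bounded_linear[OF f1]]
        bounded_linear.linear[OF has_derivative_bounded_linear[OF f2]]
      have "(h has_derivative (\<lambda>k. f' (x + s *\<^sub>R u + t *\<^sub>R v) (k *\<^sub>R u) - f' (x + s *\<^sub>R u) (k *\<^sub>R u))) (at s)"
        unfolding h_def
        using has_derivative_diff[OF has_derivative_compose[OF l(1) f1] has_derivative_compose[OF l(2) f2]] .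
      then show ?thesis
        unfolding has_field_derivative_def
        by (rule has_derivative_eq_rhs) (intro ext, simp only: linear_cmul[OF lin(1)] linear_cmul[OF lin(2)], simp add: algebra_simps)
    qed
    obtain s where s: "0 < s" "s < t" "h t - h 0 = (t - 0) * (f' (x + s *\<^sub>R u + t *\<^sub>R v) u - f' (x + s *\<^sub>R u) u)"
      using MVT2[OF t(1) dh] by blast
    define A B where "A = f' (x + s *\<^sub>R u + t *\<^sub>R v) u" and "B = f' (x + s *\<^sub>R u) u"
    have a: "\<bar>A - f' x u - P (s *\<^sub>R u + t *\<^sub>R v)\<bar> \<le> e' * (t * N)"
    proof -
      have "\<bar>A - f' x u - P (s *\<^sub>R u + t *\<^sub>R v)\<bar> \<le> e' * norm (s *\<^sub>R u + t *\<^sub>R v)"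
        using d1(2)[of "x + s *\<^sub>R u + t *\<^sub>R v"] near[of s t t] s t
        by (simp add: A_def add.assoc)
      also have "\<dots> \<le> e' * (t * N)" using near(1)[of s t t] s t e' by (intro mult_left_mono) auto
      finally show ?thesis .
    qed
    have b: "\<bar>B - f' x u - P (s *\<^sub>R u)\<bar> \<le> e' * (t * N)"
    proof -
      have "\<bar>B - f' x u - P (s *\<^sub>R u)\<bar> \<le> e' * norm (s *\<^sub>R u)"
        using d1(2)[of "x + s *\<^sub>R u"] near[of s t 0] s t by (simp add: B_def)
      also have "\<dots> \<le> e' * (t * N)" using near(1)[of s t 0] s t e' by (intro mult_left_mono) auto
      finally show ?thesis .
    qed
    have "P (s *\<^sub>R u + t *\<^sub>R v) = P (s *\<^sub>R u) + t * P v"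
      using bl by (simp add: linear_add linear_cmul bounded_linear.linear)
    then have ab: "\<bar>A - B - t * P v\<bar> \<le> 2 * (e' * (t * N))" using a b by linarith
    have num: "f (x + t *\<^sub>R u + t *\<^sub>R v) - f (x + t *\<^sub>R u) - f (x + t *\<^sub>R v) + f x = t * (A - B)"
      using s(3) by (simp add: h_def A_def B_def)
    have q: "(f (x + t *\<^sub>R u + t *\<^sub>R v) - f (x + t *\<^sub>R u) - f (x + t *\<^sub>R v) + f x) / t\<^sup>2 - P v = (A - B - t * P v) / t"
      unfolding num using t(1) by (simp add: diff_divide_distrib power2_eq_square)
    have "\<bar>(A - B - t * P v) / t\<bar> = \<bar>A - B - t * P v\<bar> / t"
      using t(1) by (simp only: abs_divide abs_of_pos)
    also have "\<dots> \<le> 2 * (e' * (t * N)) / t"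
      using ab t(1) by (intro divide_right_mono) auto
    also have "\<dots> = 2 * e' * N" using t(1) by simp
    also have "\<dots> = e * (2/3)" using N by (simp add: e'_def)
    also have "\<dots> < e" using e by simp
    finally show ?thesis unfolding q .
  qed
  then show "\<forall>\<^sub>F t in at_right 0. dist ((f (x + t *\<^sub>R u + t *\<^sub>R v) - f (x + t *\<^sub>R u) - f (x + t *\<^sub>R v) + f x) / t\<^sup>2) (P v) < e"
    using d unfolding eventually_at_right_field dist_real_def by blast
qed

text \<open>The second difference is symmetric in \<open>u\<close> and \<open>v\<close>.\<close>

lemma second_derivative_symmetric:
  fixes f :: "'a::real_normed_vector \<Rightarrow> real"
  assumes U: "open U" "x \<in> U"
    and f: "\<And>y. y \<in> U \<Longrightarrow> (f has_derivative f' y) (at y)"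
    and P: "((\<lambda>y. f' y u) has_derivative P) (at x)"
    and Q: "((\<lambda>y. f' y v) has_derivative Q) (at x)"
  shows "P v = Q u"
proof (rule tendsto_unique[OF _ second_difference_tendsto[OF U f P]])
  have "f (x + t *\<^sub>R v + t *\<^sub>R u) - f (x + t *\<^sub>R v) - f (x + t *\<^sub>R u) + f x =
      f (x + t *\<^sub>R u + t *\<^sub>R v) - f (x + t *\<^sub>R u) - f (x + t *\<^sub>R v) + f x" for t
    by (simp add: add.assoc add.commute[of "t *\<^sub>R v"])
  then show "((\<lambda>t. (f (x + t *\<^sub>R u + t *\<^sub>R v) - f (x + t *\<^sub>R u) - f (x + t *\<^sub>R v) + f x) / t\<^sup>2)
     \<longlongrightarrow> Q u) (at_right 0)"
    using second_difference_tendsto[OF U f Q, of u] by (simp only:)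
qed simp

section \<open>Partial derivatives\<close>

lemma pderiv_at_eq:
  assumes "(F has_derivative D) (at x)"
  shows "pderiv_at i F x = D (axis i 1)"
  using frechet_derivative_at[OF assms] by (simp add: pderiv_at_def)

lemma linear_eq_sum_axis:
  fixes D :: "real ^ 'n::finite \<Rightarrow> 'b::real_vector"
  assumes "linear D"
  shows "D v = (\<Sum>i\<in>UNIV. v $ i *\<^sub>R D (axis i 1))"
proof -
  have "D (\<Sum>i\<in>UNIV. v $ i *\<^sub>R axis i 1) = (\<Sum>i\<in>UNIV. v $ i *\<^sub>R D (axis i 1))"
    using assms by (simp add: linear_sum linear_cmul)
  moreover have "(\<Sum>i\<in>UNIV. v $ i *\<^sub>R axis i 1) = v"
    using basis_expansion[of v] unfolding scalar_mult_eq_scaleR .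
  ultimately show ?thesis by simp
qed

lemma frechet_derivative_eq_sum_pderiv:
  assumes "F differentiable (at x)"
  shows "frechet_derivative F (at x) v = (\<Sum>i\<in>UNIV. v $ i * pderiv_at i F x)"
  by (subst linear_eq_sum_axis[OF linear_frechet_derivative[OF assms]]) (simp add: pderiv_at_def)

lemma has_derivative_sum_pderiv:
  assumes "F differentiable (at x)"
  shows "(F has_derivative (\<lambda>v. \<Sum>i\<in>UNIV. v $ i * pderiv_at i F x)) (at x)"
  using assms frechet_derivative_works[of F "at x"]
  by (simp add: frechet_derivative_eq_sum_pderiv[OF assms, abs_def])

lemma pderiv_at_cong:
  assumes "open U" "x \<in> U" "\<And>y. y \<in> U \<Longrightarrow> F y = G y" "F differentiable (at x)"
  shows "pderiv_at i G x = pderiv_at i F x"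
  using has_derivative_transform_within_open[OF has_derivative_sum_pderiv[OF assms(4)] assms(1-3)]
  by (simp add: pderiv_at_eq axis_def if_distrib[of "\<lambda>a. a * _"] cong: if_cong)

lemma differentiable_cong_open:
  assumes "open U" "x \<in> U" "\<And>y. y \<in> U \<Longrightarrow> F y = G y" "F differentiable (at x)"
  shows "G differentiable (at x)"
  using assms has_derivative_transform_within_open unfolding differentiable_def by blast

lemma pderiv_at_mult:
  assumes "F differentiable (at x)" "G differentiable (at x)"
  shows "pderiv_at i (\<lambda>y. F y * G y) x = F x * pderiv_at i G x + pderiv_at i F x * G x"
proof -
  note h = assms[unfolded frechet_derivative_works]
  show ?thesis
    by (subst pderiv_at_eq[OF has_derivative_mult[OF h]]) (simp add: pderiv_at_def)
qed

lemma pderiv_at_diff: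
  assumes "F differentiable (at x)" "G differentiable (at x)"
  shows "pderiv_at i (\<lambda>y. F y - G y) x = pderiv_at i F x - pderiv_at i G x"
proof -
  note h = assms[unfolded frechet_derivative_works]
  show ?thesis
    by (subst pderiv_at_eq[OF has_derivative_diff[OF h]]) (simp add: pderiv_at_def)
qed

lemma pderiv_at_sum:
  assumes "\<And>k. k \<in> K \<Longrightarrow> F k differentiable (at x)"
  shows "pderiv_at i (\<lambda>y. \<Sum>k\<in>K. F k y) x = (\<Sum>k\<in>K. pderiv_at i (F k) x)"
proof -
  have "((\<lambda>y. \<Sum>k\<in>K. F k y) has_derivative (\<lambda>h. \<Sum>k\<in>K. frechet_derivative (F k) (at x) h)) (at x)"
    using assms by (intro has_derivative_sum) (auto simp: frechet_derivative_works)
  then show ?thesis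
    by (subst pderiv_at_eq) (auto simp: pderiv_at_def)
qed

lemma pderiv_at_const [simp]: "pderiv_at i (\<lambda>y. k) x = 0"
  by (simp add: pderiv_at_def)

lemma has_vector_derivative_chain_pderiv:
  fixes \<xi> :: "real \<Rightarrow> real ^ 'n::finite"
  assumes "(\<xi> has_vector_derivative v) (at t within I)" "F differentiable (at (\<xi> t))"
  shows "((\<lambda>s. F (\<xi> s)) has_real_derivative (\<Sum>i\<in>UNIV. v $ i * pderiv_at i F (\<xi> t))) (at t within I)"
proof -
  have "((\<lambda>s. F (\<xi> s)) has_derivative (\<lambda>h. \<Sum>i\<in>UNIV. (h *\<^sub>R v) $ i * pderiv_at i F (\<xi> t))) (at t within I)"
    using has_derivative_compose[OF assms(1)[unfolded has_vector_derivative_def] has_derivative_sum_pderiv[OF assms(2)]] .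
  then show ?thesis
    unfolding has_field_derivative_def
    by (rule has_derivative_eq_rhs) (auto simp: sum_distrib_left sum_distrib_right algebra_simps)
qed

text \<open>The derivative of \<open>f\<close> may be one-sided: \<open>w x\<close> can be an endpoint of the interval \<open>J\<close> of
  values, for instance at an extremum of \<open>w\<close>.\<close>

lemma pderiv_at_compose_real:
  assumes f: "(f has_real_derivative d) (at (w x) within J)"
    and U: "open U" "x \<in> U" "w ` U \<subseteq> J" and w: "w differentiable (at x)"
  shows "(\<lambda>y. f (w y)) differentiable (at x)"
    and "pderiv_at i (\<lambda>y. f (w y)) x = d * pderiv_at i w x"
proof -
  have "(w has_derivative frechet_derivative w (at x)) (at x within U)"
    using w frechet_derivative_works has_derivative_at_withinI by blast
  moreover have "(f has_derivative (*) d) (at (w x) within w ` U)"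
    using f U(3) unfolding has_field_derivative_def by (rule has_derivative_subset)
  ultimately have "((\<lambda>y. f (w y)) has_derivative (\<lambda>h. d * frechet_derivative w (at x) h)) (at x within U)"
    using has_derivative_in_compose by fastforce
  then have "((\<lambda>y. f (w y)) has_derivative (\<lambda>h. d * frechet_derivative w (at x) h)) (at x)"
    using at_within_open U by metis
  then show "(\<lambda>y. f (w y)) differentiable (at x)" "pderiv_at i (\<lambda>y. f (w y)) x = d * pderiv_at i w x"
    by (auto simp: differentiable_def pderiv_at_eq) (simp add: pderiv_at_def)
qed

lemma smooth_on_imp_differentiable:
  assumes "smooth_on S F" "x \<in> S"
  shows "F differentiable (at x)"
  using assms(1) diff_order_on.simps(2)[of 0 S F] assms(2) unfolding smooth_on_def by blast

lemma smooth_on_pderiv: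
  assumes "smooth_on S F"
  shows "smooth_on S (pderiv_at i F)"
  unfolding smooth_on_def pderiv_at_def[abs_def]
proof
  fix k
  have "diff_order_on (Suc k) S F" using assms unfolding smooth_on_def by blast
  then show "diff_order_on k S (\<lambda>x. frechet_derivative F (at x) (axis i 1))" by simp
qed

section \<open>Charts and tangent vectors\<close>

lemma atlas_props:
  assumes "smooth_manifold M" "c \<in> atlas M"
  shows "openin (top_of M) (fst c)" "open (snd c ` fst c)"
    "homeomorphic_map (subtopology (top_of M) (fst c)) (top_of_set (snd c ` fst c)) (snd c)"
    "fst c \<subseteq> pts M" "inj_on (snd c) (fst c)"
proof -
  show *: "openin (top_of M) (fst c)" "open (snd c ` fst c)"
    "homeomorphic_map (subtopology (top_of M) (fst c)) (top_of_set (snd c ` fst c)) (snd c)"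
    using assms unfolding smooth_manifold_def by auto
  show "fst c \<subseteq> pts M" using *(1) by (rule openin_subset)
  then show "inj_on (snd c) (fst c)"
    using homeomorphic_imp_injective_map[OF *(3)] by (simp add: inf.absorb2)
qed

lemma chart_inv_simps:
  assumes "smooth_manifold M" "c \<in> atlas M"
  shows "p \<in> fst c \<Longrightarrow> chart_inv c (snd c p) = p"
    and "x \<in> snd c ` fst c \<Longrightarrow> snd c (chart_inv c x) = x"
    and "x \<in> snd c ` fst c \<Longrightarrow> chart_inv c x \<in> fst c"
  using atlas_props(5)[OF assms] by (auto simp: inv_into_into f_inv_into_f)

lemma open_chart_image:
  assumes "smooth_manifold M" "c \<in> atlas M" "openin (top_of M) S"
  shows "open (snd c ` (fst c \<inter> S))"
proof -
  have "openin (subtopology (top_of M) (fst c)) (fst c \<inter> S)"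
    by (metis assms(3) inf_commute openin_subtopology)
  then have "openin (top_of_set (snd c ` fst c)) (snd c ` (fst c \<inter> S))"
    using homeomorphic_imp_open_map[OF atlas_props(3)[OF assms(1,2)]] unfolding open_map_def by blast
  then show ?thesis using atlas_props(2)[OF assms(1,2)] openin_open_eq by blast
qed

lemma coord_change_has_derivative:
  assumes "smooth_manifold M" "c \<in> charts_at M p" "d \<in> charts_at M p"
  shows "((snd d \<circ> chart_inv c) has_derivative coord_change_deriv c d p) (at (snd c p))"
proof -
  have "smooth_on (snd c ` (fst c \<inter> fst d)) (snd d \<circ> chart_inv c)"
    using assms unfolding smooth_manifold_def charts_at_def by blast
  then show ?thesis
    unfolding coord_change_deriv_def frechet_derivative_works[symmetric]
    using assms by (intro smooth_on_imp_differentiable) (auto simp: charts_at_def)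
qed

lemma chart_overlap_open:
  assumes "smooth_manifold M" "c \<in> charts_at M p" "d \<in> charts_at M p"
  shows "open (snd c ` (fst c \<inter> fst d))" "snd c p \<in> snd c ` (fst c \<inter> fst d)"
  using assms open_chart_image[of M c "fst d"] atlas_props(1)[of M d] by (auto simp: charts_at_def)

text \<open>All tensoriality used below (of tangent vectors, of differentials, of velocities) comes from
  this one instance of the chain rule.\<close>

lemma has_derivative_change_chart:
  fixes F :: "'m \<Rightarrow> 'b::real_normed_vector"
  assumes M: "smooth_manifold M" and c: "c \<in> charts_at M p" and d: "d \<in> charts_at M p"
    and F: "((F \<circ> chart_inv d) has_derivative D) (at (snd d p))"
  shows "((F \<circ> chart_inv c) has_derivative (\<lambda>v. D (coord_change_deriv c d p v))) (at (snd c p))"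
proof -
  have [simp]: "chart_inv c (snd c q) = q" if "q \<in> fst c" for q
    using chart_inv_simps(1)[OF M] c that by (auto simp: charts_at_def)
  have [simp]: "chart_inv d (snd d q) = q" if "q \<in> fst d" for q
    using chart_inv_simps(1)[OF M] d that by (auto simp: charts_at_def)
  have p: "p \<in> fst c" "p \<in> fst d" using c d by (auto simp: charts_at_def)
  have "((\<lambda>x. (F \<circ> chart_inv d) ((snd d \<circ> chart_inv c) x)) has_derivative
      (\<lambda>v. D (coord_change_deriv c d p v))) (at (snd c p))"
    using p F by (intro has_derivative_compose[OF coord_change_has_derivative[OF M c d]]) (simp add: o_def)
  then show ?thesis
    by (rule has_derivative_transform_within_open[OF _ chart_overlap_open[OF M c d]]) (auto simp: p)
qed

lemma coord_change_deriv_trans: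
  assumes "smooth_manifold M" "c \<in> charts_at M p" "d \<in> charts_at M p" "e \<in> charts_at M p"
  shows "coord_change_deriv d e p (coord_change_deriv c d p v) = coord_change_deriv c e p v"
  using has_derivative_unique[OF has_derivative_change_chart[OF assms(1-3)
      coord_change_has_derivative[OF assms(1,3,4)]] coord_change_has_derivative[OF assms(1,2,4)]]
  by (rule fun_cong)

lemma coord_change_deriv_self:
  assumes "smooth_manifold M" "c \<in> charts_at M p"
  shows "coord_change_deriv c c p v = v"
proof -
  have "((\<lambda>x. x) has_derivative (\<lambda>v. v)) (at (snd c p))" by simp
  then have "((snd c \<circ> chart_inv c) has_derivative (\<lambda>v. v)) (at (snd c p))"
    by (rule has_derivative_transform_within_open[OF _ chart_overlap_open[OF assms assms(2)]])
      (use chart_inv_simps(1)[OF assms(1)] assms in \<open>auto simp: charts_at_def\<close>)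
  from has_derivative_unique[OF this coord_change_has_derivative[OF assms assms(2)]]
  show ?thesis by metis
qed

text \<open>The tangent vector at \<open>p\<close> with prescribed components in one chart.\<close>

definition tvec_of :: "('m, 'n::finite) riem \<Rightarrow> ('m, 'n) chart \<Rightarrow> 'm \<Rightarrow> real ^ 'n \<Rightarrow> ('m, 'n) tvec"
  where "tvec_of M c p v = (\<lambda>d. if d \<in> charts_at M p then coord_change_deriv c d p v else 0)"

lemma coord_vec_eq_tvec_of: "coord_vec M c p i = tvec_of M c p (axis i 1)"
  by (simp add: coord_vec_def tvec_of_def fun_eq_iff)

lemma tvec_of_in_tangent_space:
  assumes "smooth_manifold M" "c \<in> charts_at M p"
  shows "tvec_of M c p v \<in> tangent_space M p"
  using assms by (auto simp: tangent_space_def tvec_of_def coord_change_deriv_trans)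

lemma tvec_of_component:
  assumes "smooth_manifold M" "c \<in> charts_at M p"
  shows "tvec_of M c p v c = v"
  using assms by (auto simp: tvec_of_def coord_change_deriv_self)

lemma tvec_of_tangent_vector:
  assumes "X \<in> tangent_space M p" "c \<in> charts_at M p"
  shows "tvec_of M c p (X c) = X"
proof
  fix d
  have "d \<in> charts_at M p \<Longrightarrow> X d = coord_change_deriv c d p (X c)" "d \<notin> charts_at M p \<Longrightarrow> X d = 0"
    using assms unfolding tangent_space_def by blast+
  then show "tvec_of M c p (X c) d = X d"
    unfolding tvec_of_def by (cases "d \<in> charts_at M p") (simp_all only: if_True if_False simp_thms)
qed

lemma tvec_of_add_scaleR:
  assumes "smooth_manifold M" "c \<in> charts_at M p"
  shows "tvec_of M c p (a *\<^sub>R v + b *\<^sub>R w) = (\<lambda>d. a *\<^sub>R tvec_of M c p v d + b *\<^sub>R tvec_of M c p w d)"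
proof
  fix d
  show "tvec_of M c p (a *\<^sub>R v + b *\<^sub>R w) d = a *\<^sub>R tvec_of M c p v d + b *\<^sub>R tvec_of M c p w d"
  proof (cases "d \<in> charts_at M p")
    case True
    from bounded_linear.linear[OF has_derivative_bounded_linear[OF coord_change_has_derivative[OF assms True]]]
    show ?thesis using True by (simp add: tvec_of_def linear_add linear_cmul)
  qed (simp add: tvec_of_def)
qed

text \<open>By definition the metric coefficients are the values on coordinate vectors; bilinearity and
  the expansion of a tangent vector in coordinate vectors recover the metric from them.\<close>

lemma metric_in_chart:
  assumes R: "riemannian_manifold M" and c: "c \<in> charts_at M p"
    and X: "X \<in> tangent_space M p" and Y: "Y \<in> tangent_space M p"
  shows "metric M p X Y = (\<Sum>i\<in>UNIV. \<Sum>j\<in>UNIV. metric_coeff M c i j (snd c p) * X c $ i * Y c $ j)"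
proof -
  have M: "smooth_manifold M" using R by (simp add: riemannian_manifold_def)
  have cp: "c \<in> atlas M" "p \<in> fst c" using c by (auto simp: charts_at_def)
  have p: "p \<in> pts M" using atlas_props(4)[OF M cp(1)] cp by auto
  have T: "tvec_of M c p v \<in> tangent_space M p" for v
    by (rule tvec_of_in_tangent_space[OF M c])
  have comm: "metric M p A B = metric M p B A" if "A \<in> tangent_space M p" "B \<in> tangent_space M p" for A B
    using R p that unfolding riemannian_manifold_def by blast
  have lin: "linear (\<lambda>v. metric M p (tvec_of M c p v) Z)" if "Z \<in> tangent_space M p" for Z
  proof (rule linearI)
    have bil: "metric M p (tvec_of M c p (a *\<^sub>R v + b *\<^sub>R w)) Z =
        a * metric M p (tvec_of M c p v) Z + b * metric M p (tvec_of M c p w) Z" for a b v w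
      unfolding tvec_of_add_scaleR[OF M c]
      using R p T that unfolding riemannian_manifold_def by blast
    show "metric M p (tvec_of M c p (v + w)) Z = metric M p (tvec_of M c p v) Z + metric M p (tvec_of M c p w) Z" for v w
      using bil[of 1 v 1 w] by simp
    show "metric M p (tvec_of M c p (a *\<^sub>R v)) Z = a *\<^sub>R metric M p (tvec_of M c p v) Z" for a v
      using bil[of a v 0 v] by simp
  qed
  have expand: "metric M p (tvec_of M c p v) Z = (\<Sum>i\<in>UNIV. v $ i * metric M p (coord_vec M c p i) Z)"
    if "Z \<in> tangent_space M p" for v Z
    using linear_eq_sum_axis[OF lin[OF that], of v] by (simp add: coord_vec_eq_tvec_of)
  have cv: "coord_vec M c p i \<in> tangent_space M p" for i
    by (simp add: coord_vec_eq_tvec_of T)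
  have "metric M p X Y = (\<Sum>i\<in>UNIV. X c $ i * metric M p (coord_vec M c p i) Y)"
    using expand[OF Y, of "X c"] tvec_of_tangent_vector[OF X c] by simp
  also have "\<dots> = (\<Sum>i\<in>UNIV. X c $ i * (\<Sum>j\<in>UNIV. Y c $ j * metric M p (coord_vec M c p i) (coord_vec M c p j)))"
  proof -
    have "metric M p (coord_vec M c p i) Y =
        (\<Sum>j\<in>UNIV. Y c $ j * metric M p (coord_vec M c p i) (coord_vec M c p j))" for i
      using expand[OF cv[of i], of "Y c"]
      by (simp only: tvec_of_tangent_vector[OF Y c] comm[OF cv[of i] Y] comm[OF cv cv[of i]])
    then show ?thesis by (simp only:)
  qed
  also have "\<dots> = (\<Sum>i\<in>UNIV. \<Sum>j\<in>UNIV. metric_coeff M c i j (snd c p) * X c $ i * Y c $ j)"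
    using chart_inv_simps(1)[OF M cp]
    by (simp add: sum_distrib_left metric_coeff_def algebra_simps)
  finally show ?thesis .
qed

section \<open>The Levi-Civita connection in a chart\<close>

lemma differentiable_sum_fun:
  fixes F :: "'k \<Rightarrow> 'a::real_normed_vector \<Rightarrow> 'b::real_normed_vector"
  assumes "\<And>k. k \<in> K \<Longrightarrow> F k differentiable net"
  shows "(\<lambda>y. \<Sum>k\<in>K. F k y) differentiable net"
proof (cases "finite K")
  case True
  then show ?thesis using assms by (induction K rule: finite_induct) auto
qed simp

lemma differentiable_prod_fun:
  fixes F :: "'k \<Rightarrow> 'a::real_normed_vector \<Rightarrow> 'b::real_normed_field"
  assumes "\<And>k. k \<in> K \<Longrightarrow> F k differentiable (at x)"
  shows "(\<lambda>y. \<Prod>k\<in>K. F k y) differentiable (at x)"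
proof (cases "finite K")
  case True
  then show ?thesis using assms by (induction K rule: finite_induct) auto
qed simp

lemma differentiable_det:
  fixes A :: "'a::real_normed_vector \<Rightarrow> real ^ 'n ^ 'n::finite"
  assumes "\<And>i j. (\<lambda>y. A y $ i $ j) differentiable (at x)"
  shows "(\<lambda>y. det (A y)) differentiable (at x)"
  unfolding det_def
  by (intro differentiable_sum_fun differentiable_mult differentiable_prod_fun differentiable_const assms)

lemma matrix_inv_works:
  fixes A :: "real ^ 'n ^ 'n::finite"
  assumes "invertible A"
  shows "A ** matrix_inv A = mat 1" "matrix_inv A ** A = mat 1"
proof -
  have "A ** matrix_inv A = mat 1 \<and> matrix_inv A ** A = mat 1"
    using assms unfolding invertible_def matrix_inv_def by (rule someI_ex)
  then show "A ** matrix_inv A = mat 1" "matrix_inv A ** A = mat 1" by auto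
qed

text \<open>Cramer's rule expresses the entries of the inverse by determinants, which makes the inverse
  metric differentiable.\<close>

lemma matrix_inv_eq_cramer:
  fixes A :: "real ^ 'n ^ 'n::finite"
  assumes "invertible A"
  shows "matrix_inv A $ k $ j = det (\<chi> a b. if b = k then axis j 1 $ a else A $ a $ b) / det A"
proof -
  have "A *v column j (matrix_inv A) = axis j 1"
    by (metis assms matrix_inv_works(1) matrix_vector_mul_assoc matrix_vector_mul_lid matrix_vector_mult_basis)
  from cramer_lemma[of k A "column j (matrix_inv A)", unfolded this]
  show ?thesis
    using assms by (simp add: invertible_det_nz column_def field_simps)
qed

text \<open>The components of the gradient of the function with coordinate expression \<open>h\<close>.\<close>

definition gradient_coeff ::
    "('m, 'n::finite) riem \<Rightarrow> ('m, 'n) chart \<Rightarrow> (real ^ 'n \<Rightarrow> real) \<Rightarrow> 'n \<Rightarrow> real ^ 'n \<Rightarrow> real"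
  where "gradient_coeff M c h i x = (\<Sum>k\<in>UNIV. inverse_metric_coeff M c i k x * pderiv_at k h x)"

locale riem_chart =
  fixes M :: "('m, 'n::finite) riem" and c :: "('m, 'n) chart"
  assumes riem: "riemannian_manifold M" and chart: "c \<in> atlas M"
begin

abbreviation U where "U \<equiv> snd c ` fst c"
abbreviation g where "g \<equiv> metric_coeff M c"
abbreviation ginv where "ginv \<equiv> inverse_metric_coeff M c"
abbreviation \<Gamma> where "\<Gamma> \<equiv> christoffel M c"

lemma smooth_mfd: "smooth_manifold M"
  using riem by (simp add: riemannian_manifold_def)

lemma open_U: "open U"
  by (rule atlas_props(2)[OF smooth_mfd chart])

lemma chart_at: "x \<in> U \<Longrightarrow> c \<in> charts_at M (chart_inv c x)"
  using chart chart_inv_simps(3)[OF smooth_mfd chart] by (simp add: charts_at_def)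

lemma smooth_g: "smooth_on U (g i j)"
  using riem chart by (simp add: riemannian_manifold_def)

lemma differentiable_g: "x \<in> U \<Longrightarrow> g i j differentiable (at x)"
  by (rule smooth_on_imp_differentiable[OF smooth_g])

lemma differentiable_pderiv_g: "x \<in> U \<Longrightarrow> pderiv_at k (g i j) differentiable (at x)"
  by (rule smooth_on_imp_differentiable[OF smooth_on_pderiv[OF smooth_g]])

lemma g_sym: assumes "x \<in> U" shows "g i j x = g j i x"
proof -
  have "chart_inv c x \<in> pts M"
    using assms chart_inv_simps(3)[OF smooth_mfd chart] atlas_props(4)[OF smooth_mfd chart] by blast
  moreover have "coord_vec M c (chart_inv c x) k \<in> tangent_space M (chart_inv c x)" for k
    unfolding coord_vec_eq_tvec_of by (rule tvec_of_in_tangent_space[OF smooth_mfd chart_at[OF assms]])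
  ultimately show ?thesis
    using riem unfolding metric_coeff_def riemannian_manifold_def by blast
qed

lemma pderiv_g_sym:
  assumes "x \<in> U" shows "pderiv_at k (g i j) x = pderiv_at k (g j i) x"
  by (rule pderiv_at_cong[OF open_U assms g_sym differentiable_g[OF assms]])

lemma g_pos:
  assumes "x \<in> U" "v \<noteq> 0"
  shows "0 < (\<Sum>i\<in>UNIV. \<Sum>j\<in>UNIV. g i j x * v $ i * v $ j)"
proof -
  define p where "p = chart_inv c x"
  have p: "p \<in> pts M" "snd c p = x"
    using assms(1) chart_inv_simps(2,3)[OF smooth_mfd chart] atlas_props(4)[OF smooth_mfd chart]
    by (auto simp: p_def)
  have cp: "c \<in> charts_at M p" using chart_at[OF assms(1)] by (simp add: p_def)
  note T = tvec_of_in_tangent_space[OF smooth_mfd cp] and comp = tvec_of_component[OF smooth_mfd cp]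
  have "tvec_of M c p v \<noteq> (\<lambda>_. 0)"
    using comp[of v] assms(2) by auto
  then have "0 < metric M p (tvec_of M c p v) (tvec_of M c p v)"
    using riem p(1) T unfolding riemannian_manifold_def by blast
  then show ?thesis
    unfolding metric_in_chart[OF riem cp T T] comp p(2) .
qed

lemma invertible_g: assumes "x \<in> U" shows "invertible (\<chi> k l. g k l x)"
proof -
  have "v = 0" if "(\<chi> k l. g k l x) *v v = 0" for v
  proof (rule ccontr)
    assume "v \<noteq> 0"
    have "(\<Sum>j\<in>UNIV. g i j x * v $ j) = 0" for i
      using that by (simp add: vec_eq_iff matrix_vector_mult_def)
    then have "(\<Sum>i\<in>UNIV. v $ i * (\<Sum>j\<in>UNIV. g i j x * v $ j)) = 0" by simp
    then have "(\<Sum>i\<in>UNIV. \<Sum>j\<in>UNIV. g i j x * v $ i * v $ j) = 0"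
      by (simp add: sum_distrib_left mult_ac)
    with g_pos[OF assms \<open>v \<noteq> 0\<close>] show False by simp
  qed
  then show ?thesis
    unfolding invertible_left_inverse matrix_left_invertible_ker by blast
qed

lemma g_ginv:
  assumes "x \<in> U"
  shows "(\<Sum>k\<in>UNIV. g i k x * ginv k j x) = (if i = j then 1 else 0)"
  using matrix_inv_works(1)[OF invertible_g[OF assms]]
  by (simp add: vec_eq_iff matrix_matrix_mult_def mat_def inverse_metric_coeff_def)

lemma ginv_g:
  assumes "x \<in> U"
  shows "(\<Sum>k\<in>UNIV. ginv i k x * g k j x) = (if i = j then 1 else 0)"
  using matrix_inv_works(2)[OF invertible_g[OF assms]]
  by (simp add: vec_eq_iff matrix_matrix_mult_def mat_def inverse_metric_coeff_def)

lemma raise_index: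
  assumes x: "x \<in> U" and eq: "\<And>m. (\<Sum>k\<in>UNIV. g m k x * a k) = b m"
  shows "a i = (\<Sum>m\<in>UNIV. ginv i m x * b m)"
proof -
  have "(\<Sum>m\<in>UNIV. ginv i m x * b m) = (\<Sum>m\<in>UNIV. \<Sum>k\<in>UNIV. ginv i m x * g m k x * a k)"
    by (simp add: eq[symmetric] sum_distrib_left mult.assoc)
  also have "\<dots> = (\<Sum>k\<in>UNIV. (\<Sum>m\<in>UNIV. ginv i m x * g m k x) * a k)"
    by (subst sum.swap) (simp add: sum_distrib_right)
  also have "\<dots> = a i"
    by (simp add: ginv_g[OF x] if_distrib[of "\<lambda>b. b * _"] cong: if_cong)
  finally show ?thesis ..
qed

lemma lower_index:
  assumes x: "x \<in> U" and eq: "\<And>k. a k = (\<Sum>m\<in>UNIV. ginv k m x * b m)"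
  shows "(\<Sum>k\<in>UNIV. g i k x * a k) = b i"
proof -
  have "(\<Sum>k\<in>UNIV. g i k x * a k) = (\<Sum>k\<in>UNIV. \<Sum>m\<in>UNIV. g i k x * ginv k m x * b m)"
    by (simp add: eq sum_distrib_left mult.assoc)
  also have "\<dots> = (\<Sum>m\<in>UNIV. (\<Sum>k\<in>UNIV. g i k x * ginv k m x) * b m)"
    by (subst sum.swap) (simp add: sum_distrib_right)
  also have "\<dots> = b i"
    by (simp add: g_ginv[OF x] if_distrib[of "\<lambda>b. b * _"] cong: if_cong)
  finally show ?thesis .
qed

lemma differentiable_ginv:
  assumes "x \<in> U" shows "ginv k j differentiable (at x)"
proof -
  have d: "(\<lambda>y. det (\<chi> a b. if b = k then axis j 1 $ a else g a b y) / det (\<chi> a b. g a b y)) differentiable (at x)"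
  proof (intro differentiable_divide differentiable_det)
    show "(\<lambda>y. (\<chi> a b. if b = k then axis j 1 $ a else g a b y) $ i $ l) differentiable (at x)" for i l
      using differentiable_g[OF assms] by (cases "l = k") auto
    show "(\<lambda>y. (\<chi> a b. g a b y) $ i $ l) differentiable (at x)" for i l
      using differentiable_g[OF assms] by simp
    show "det (\<chi> a b. g a b x) \<noteq> 0"
      using invertible_g[OF assms] by (simp add: invertible_det_nz)
  qed
  show ?thesis
  proof (rule differentiable_cong_open[OF open_U assms _ d])
    fix y assume "y \<in> U"
    from matrix_inv_eq_cramer[OF invertible_g[OF this], of k j]
    show "det (\<chi> a b. if b = k then axis j 1 $ a else g a b y) / det (\<chi> a b. g a b y) = ginv k j y"
      by (simp add: inverse_metric_coeff_def cong: if_cong)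
  qed
qed

lemma differentiable_christoffel:
  assumes "x \<in> U" shows "\<Gamma> k i j differentiable (at x)"
  unfolding christoffel_def[abs_def]
  by (intro differentiable_divide differentiable_sum_fun differentiable_mult differentiable_diff
      differentiable_add differentiable_const differentiable_ginv differentiable_pderiv_g assms) simp

lemma christoffel_sym:
  assumes "x \<in> U" shows "\<Gamma> k i j x = \<Gamma> k j i x"
  unfolding christoffel_def using pderiv_g_sym[OF assms, of _ i j] by (simp add: add.commute)

text \<open>The Koszul formula for coordinate vector fields.\<close>

lemma lower_christoffel:
  assumes "x \<in> U"
  shows "(\<Sum>k\<in>UNIV. g m k x * \<Gamma> k i j x) =
    (pderiv_at i (g j m) x + pderiv_at j (g i m) x - pderiv_at m (g i j) x) / 2"
  by (rule lower_index[OF assms]) (simp add: christoffel_def sum_divide_distrib)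

lemma lower_gradient:
  assumes "x \<in> U"
  shows "(\<Sum>k\<in>UNIV. g i k x * gradient_coeff M c h k x) = pderiv_at i h x"
  by (rule lower_index[OF assms]) (simp add: gradient_coeff_def)

text \<open>Below, \<open>h\<close> is the coordinate expression of \<open>w\<close> and \<open>F\<close> that of \<open>f(w)\<close>.\<close>

context
  fixes h F :: "real ^ 'n \<Rightarrow> real"
  assumes smooth_h: "smooth_on U h"
    and hess: "\<And>x i j. x \<in> U \<Longrightarrow> pderiv_at i (pderiv_at j h) x =
        (\<Sum>k\<in>UNIV. \<Gamma> k i j x * pderiv_at k h x) - F x * g i j x"
begin

lemma differentiable_pderiv_h: "x \<in> U \<Longrightarrow> pderiv_at k h differentiable (at x)"
  by (rule smooth_on_imp_differentiable[OF smooth_on_pderiv[OF smooth_h]])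

lemma differentiable_gradient: "x \<in> U \<Longrightarrow> gradient_coeff M c h i differentiable (at x)"
  unfolding gradient_coeff_def[abs_def]
  by (intro differentiable_sum_fun differentiable_mult differentiable_ginv differentiable_pderiv_h)

text \<open>This is \<open>\<nabla>\<^sub>X W = - F X\<close>, the Obata equation with one index raised. Differentiating
  \<open>g W = dh\<close> and inserting the Hessian equation leaves first derivatives of the metric, which combine to
  the remaining Christoffel term. The vector form is preferable to the covector form: its
  antisymmetrised derivative is the curvature in the very shape \<open>R(X, Z) W\<close> that the Jacobi
  equation contains once \<open>W = u' \<gamma>'\<close> is known.\<close>

lemma pderiv_gradient:
  assumes x: "x \<in> U"
  shows "pderiv_at j (gradient_coeff M c h i) x =
    - (\<Sum>l\<in>UNIV. \<Gamma> i j l x * gradient_coeff M c h l x) - (if i = j then F x else 0)"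
proof -
  let ?W = "gradient_coeff M c h"
  define a where "a k = pderiv_at j (?W k) x + (\<Sum>l\<in>UNIV. \<Gamma> k j l x * ?W l x) + (if k = j then F x else 0)" for k
  \<comment> \<open>The claim is \<open>a = 0\<close>; it is checked after lowering the index with \<open>g\<close>.\<close>
  have "(\<Sum>k\<in>UNIV. g m k x * a k) = 0" for m
  proof -
    have "pderiv_at j (\<lambda>y. \<Sum>k\<in>UNIV. g m k y * ?W k y) x = pderiv_at j (pderiv_at m h) x"
      by (rule pderiv_at_cong[OF open_U x _ differentiable_pderiv_h[OF x]]) (simp add: lower_gradient)
    also have "\<dots> = (\<Sum>k\<in>UNIV. \<Gamma> k j m x * pderiv_at k h x) - F x * g j m x"
      by (rule hess[OF x])
    also have "(\<Sum>k\<in>UNIV. \<Gamma> k j m x * pderiv_at k h x) =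
        (\<Sum>k\<in>UNIV. \<Sum>l\<in>UNIV. g l k x * \<Gamma> k j m x * ?W l x)"
      by (simp add: lower_gradient[OF x, symmetric] sum_distrib_left g_sym[OF x] mult_ac)
    also have "\<dots> = (\<Sum>l\<in>UNIV. (\<Sum>k\<in>UNIV. g l k x * \<Gamma> k j m x) * ?W l x)"
      by (subst sum.swap) (simp add: sum_distrib_right)
    finally have 1: "pderiv_at j (\<lambda>y. \<Sum>k\<in>UNIV. g m k y * ?W k y) x =
       (\<Sum>l\<in>UNIV. (pderiv_at j (g m l) x + pderiv_at m (g j l) x - pderiv_at l (g j m) x) / 2 * ?W l x) - F x * g j m x"
      by (simp add: lower_christoffel[OF x])
    have 2: "pderiv_at j (\<lambda>y. \<Sum>k\<in>UNIV. g m k y * ?W k y) x =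
        (\<Sum>k\<in>UNIV. g m k x * pderiv_at j (?W k) x) + (\<Sum>k\<in>UNIV. pderiv_at j (g m k) x * ?W k x)"
      by (simp add: pderiv_at_sum pderiv_at_mult differentiable_g[OF x] differentiable_gradient[OF x] sum.distrib)
    have "(\<Sum>k\<in>UNIV. g m k x * (\<Sum>l\<in>UNIV. \<Gamma> k j l x * ?W l x)) =
        (\<Sum>l\<in>UNIV. (\<Sum>k\<in>UNIV. g m k x * \<Gamma> k j l x) * ?W l x)"
      unfolding sum_distrib_left sum_distrib_right by (subst sum.swap) (simp add: mult_ac)
    also have "\<dots> = (\<Sum>l\<in>UNIV. (pderiv_at j (g l m) x + pderiv_at l (g j m) x - pderiv_at m (g j l) x) / 2 * ?W l x)"
      by (simp add: lower_christoffel[OF x])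
    finally have 3: "(\<Sum>k\<in>UNIV. g m k x * (\<Sum>l\<in>UNIV. \<Gamma> k j l x * ?W l x)) =
      (\<Sum>l\<in>UNIV. (pderiv_at j (g m l) x + pderiv_at l (g j m) x - pderiv_at m (g j l) x) / 2 * ?W l x)"
      by (simp add: pderiv_g_sym[OF x, of j _ m])
    have 4: "(\<Sum>l\<in>UNIV. (pderiv_at j (g m l) x + pderiv_at m (g j l) x - pderiv_at l (g j m) x) / 2 * ?W l x) +
      (\<Sum>l\<in>UNIV. (pderiv_at j (g m l) x + pderiv_at l (g j m) x - pderiv_at m (g j l) x) / 2 * ?W l x) =
      (\<Sum>k\<in>UNIV. pderiv_at j (g m k) x * ?W k x)"
      unfolding sum.distrib[symmetric] by (intro sum.cong refl) (simp add: field_simps)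
    have 5: "(\<Sum>k\<in>UNIV. g m k x * (if k = j then F x else 0)) = g m j x * F x"
      by (simp add: if_distrib[of "\<lambda>b. _ * b"] cong: if_cong)
    have "(\<Sum>k\<in>UNIV. g m k x * a k) = (\<Sum>k\<in>UNIV. g m k x * pderiv_at j (?W k) x)
        + (\<Sum>k\<in>UNIV. g m k x * (\<Sum>l\<in>UNIV. \<Gamma> k j l x * ?W l x)) + g m j x * F x"
      unfolding a_def distrib_left sum.distrib 5 ..
    then show ?thesis using 1 2 3 4 g_sym[OF x, of j m] by (simp add: mult.commute)
  qed
  from raise_index[OF x this, of i] have "a i = 0" by simp
  then show ?thesis by (simp add: a_def)
qed

text \<open>The identity \<open>R(X, Z) W = dF(Z) X - dF(X) Z\<close>. It expresses the symmetry of the second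
  derivatives of \<open>W\<close>, computed by differentiating \<open>\<nabla>\<^sub>X W = - F X\<close>; the terms that contain
  \<open>F\<close> undifferentiated cancel because the connection is torsion free.\<close>

lemma curvature_gradient:
  assumes x: "x \<in> U" and F: "\<And>y. y \<in> U \<Longrightarrow> F differentiable (at y)"
  shows "(\<Sum>k\<in>UNIV. curvature_coeff M c i k m j x * gradient_coeff M c h k x) =
    (if i = m then pderiv_at j F x else 0) - (if i = j then pderiv_at m F x else 0)"
proof -
  let ?W = "gradient_coeff M c h"
  have second: "pderiv_at m (pderiv_at j (?W i)) x =
      - (\<Sum>k\<in>UNIV. pderiv_at m (\<Gamma> i j k) x * ?W k x)
      + (\<Sum>l\<in>UNIV. (\<Sum>k\<in>UNIV. \<Gamma> i j k x * \<Gamma> k m l x) * ?W l x) + \<Gamma> i j m x * F x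
      - (if i = j then pderiv_at m F x else 0)"
    and diff: "pderiv_at j (?W i) differentiable (at x)" for m j
  proof -
    let ?R = "\<lambda>y. (0 - (\<Sum>l\<in>UNIV. \<Gamma> i j l y * ?W l y)) - (if i = j then F y else 0)"
    have dR: "(\<lambda>y. \<Sum>l\<in>UNIV. \<Gamma> i j l y * ?W l y) differentiable (at x)"
      by (intro differentiable_sum_fun differentiable_mult differentiable_christoffel differentiable_gradient x)
    have dF: "(\<lambda>y. if i = j then F y else 0) differentiable (at x)"
      using F[OF x] by (cases "i = j") auto
    have eq: "?R y = pderiv_at j (?W i) y" if "y \<in> U" for y
      using pderiv_gradient[OF that] by simp
    have d: "?R differentiable (at x)"
      by (intro differentiable_diff dR dF differentiable_const)
    show "pderiv_at j (?W i) differentiable (at x)"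
      by (rule differentiable_cong_open[OF open_U x eq d])
    have "pderiv_at m (pderiv_at j (?W i)) x = pderiv_at m ?R x"
      by (rule pderiv_at_cong[OF open_U x eq d])
    also have "\<dots> = - pderiv_at m (\<lambda>y. \<Sum>l\<in>UNIV. \<Gamma> i j l y * ?W l y) x - pderiv_at m (\<lambda>y. if i = j then F y else 0) x"
      by (subst pderiv_at_diff[OF differentiable_diff[OF differentiable_const dR] dF],
          subst pderiv_at_diff[OF differentiable_const dR]) simp
    also have "pderiv_at m (\<lambda>y. if i = j then F y else 0) x = (if i = j then pderiv_at m F x else 0)"
      by simp
    also have "pderiv_at m (\<lambda>y. \<Sum>l\<in>UNIV. \<Gamma> i j l y * ?W l y) x =
        (\<Sum>l\<in>UNIV. \<Gamma> i j l x * pderiv_at m (?W l) x) + (\<Sum>l\<in>UNIV. pderiv_at m (\<Gamma> i j l) x * ?W l x)"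
      by (simp add: pderiv_at_sum pderiv_at_mult differentiable_christoffel[OF x] differentiable_gradient[OF x] sum.distrib)
    also have "(\<Sum>l\<in>UNIV. \<Gamma> i j l x * pderiv_at m (?W l) x) =
        - (\<Sum>k\<in>UNIV. \<Sum>l\<in>UNIV. \<Gamma> i j k x * \<Gamma> k m l x * ?W l x) - (\<Sum>k\<in>UNIV. if k = m then \<Gamma> i j k x * F x else 0)"
      unfolding sum_negf[symmetric] sum_subtractf[symmetric]
      by (intro sum.cong refl) (simp add: pderiv_gradient[OF x] right_diff_distrib sum_distrib_left mult.assoc sum_negf)
    also have "(\<Sum>k\<in>UNIV. if k = m then \<Gamma> i j k x * F x else 0) = \<Gamma> i j m x * F x"
      by simp
    also have "(\<Sum>k\<in>UNIV. \<Sum>l\<in>UNIV. \<Gamma> i j k x * \<Gamma> k m l x * ?W l x) =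
        (\<Sum>l\<in>UNIV. (\<Sum>k\<in>UNIV. \<Gamma> i j k x * \<Gamma> k m l x) * ?W l x)"
      by (subst sum.swap) (simp add: sum_distrib_right)
    finally show "pderiv_at m (pderiv_at j (?W i)) x =
      - (\<Sum>k\<in>UNIV. pderiv_at m (\<Gamma> i j k) x * ?W k x)
      + (\<Sum>l\<in>UNIV. (\<Sum>k\<in>UNIV. \<Gamma> i j k x * \<Gamma> k m l x) * ?W l x) + \<Gamma> i j m x * F x
      - (if i = j then pderiv_at m F x else 0)"
      by simp
  qed
  have "pderiv_at m (pderiv_at j (?W i)) x = pderiv_at j (pderiv_at m (?W i)) x"
  proof -
    have "(?W i has_derivative frechet_derivative (?W i) (at y)) (at y)" if "y \<in> U" for y
      using differentiable_gradient[OF that] frechet_derivative_works by blast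
    moreover have "((\<lambda>y. frechet_derivative (?W i) (at y) (axis j 1)) has_derivative
        frechet_derivative (pderiv_at j (?W i)) (at x)) (at x)" for j
      using diff[of j] unfolding frechet_derivative_works by (simp add: pderiv_at_def[abs_def])
    ultimately show ?thesis
      using second_derivative_symmetric[OF open_U x, of "?W i" "\<lambda>y. frechet_derivative (?W i) (at y)" "axis j 1"
          "frechet_derivative (pderiv_at j (?W i)) (at x)" "axis m 1" "frechet_derivative (pderiv_at m (?W i)) (at x)"]
      by (simp add: pderiv_at_def[of _ "pderiv_at _ _"])
  qed
  moreover have "(\<Sum>k\<in>UNIV. curvature_coeff M c i k m j x * ?W k x) =
     (\<Sum>k\<in>UNIV. pderiv_at m (\<Gamma> i j k) x * ?W k x) - (\<Sum>k\<in>UNIV. pderiv_at j (\<Gamma> i m k) x * ?W k x)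
     + (\<Sum>l\<in>UNIV. (\<Sum>k\<in>UNIV. \<Gamma> i m k x * \<Gamma> k j l x) * ?W l x)
     - (\<Sum>l\<in>UNIV. (\<Sum>k\<in>UNIV. \<Gamma> i j k x * \<Gamma> k m l x) * ?W l x)"
    unfolding curvature_coeff_def
    by (simp add: sum.distrib sum_subtractf distrib_right left_diff_distrib)
  ultimately show ?thesis
    unfolding second using christoffel_sym[OF x, of i j m] by simp
qed

end

end

section \<open>The critical value is not a zero of \<open>f\<close>\<close>

lemma smooth_within_real_C1:
  fixes f :: "real \<Rightarrow> real"
  assumes "smooth_within J J f"
  obtains f' where "\<And>s. s \<in> J \<Longrightarrow> (f has_real_derivative f' s) (at s within J)" "continuous_on J f'"
proof
  have d: "iter_deriv J k f differentiable (at s within J)" if "s \<in> J" for s k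
    using assms that unfolding smooth_within_def by blast
  show "(f has_real_derivative iter_deriv J 1 f s) (at s within J)" if "s \<in> J" for s
    using d[OF that, of 0] vector_derivative_works[of f "at s within J"]
    by (simp add: has_real_derivative_iff_has_vector_derivative)
  show "continuous_on J (iter_deriv J 1 f)"
    using d[of _ 1] differentiable_imp_continuous_within
    unfolding continuous_on_eq_continuous_within by blast
qed

lemma C1_lipschitz_on_compact:
  fixes f :: "real \<Rightarrow> real"
  assumes J: "is_interval J" and f: "\<And>s. s \<in> J \<Longrightarrow> (f has_real_derivative f' s) (at s within J)"
    and f': "continuous_on J f'" and C: "compact C" "C \<subseteq> J"
  obtains B where "B \<ge> 0" "\<And>s r. s \<in> C \<Longrightarrow> r \<in> C \<Longrightarrow> \<bar>f s - f r\<bar> \<le> B * \<bar>s - r\<bar>"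
proof -
  define H where "H = convex hull C"
  have HJ: "H \<subseteq> J"
    unfolding H_def using C(2) J by (intro hull_minimal) (auto simp: is_interval_convex)
  have "compact (f' ` H)"
    using C(1) HJ f' by (intro compact_continuous_image) (auto simp: H_def compact_convex_hull continuous_on_subset)
  then obtain B where B: "B > 0" "\<And>y. y \<in> f' ` H \<Longrightarrow> norm y \<le> B"
    using compact_imp_bounded bounded_pos by metis
  show ?thesis
  proof (rule that[of B])
    fix s r assume "s \<in> C" "r \<in> C"
    then have "s \<in> H" "r \<in> H" by (auto simp: H_def hull_inc)
    then have "norm (f s - f r) \<le> B * norm (s - r)"
      using B f HJ by (intro field_differentiable_bound[of H f f' B s r])
        (auto simp: H_def intro: DERIV_subset)
    then show "\<bar>f s - f r\<bar> \<le> B * \<bar>s - r\<bar>" by simp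
  qed (use B in auto)
qed

text \<open>Locally Lipschitz right hand side: on a segment both solutions stay in a compact subset of
  \<open>J\<close>, where \<open>f\<close> has a Lipschitz constant.\<close>

lemma second_order_ode_unique:
  fixes f a b :: "real \<Rightarrow> real"
  assumes J: "is_interval J" and f: "\<And>s. s \<in> J \<Longrightarrow> (f has_real_derivative f' s) (at s within J)"
    and f': "continuous_on J f'"
    and I: "is_interval I" "t0 \<in> I"
    and a: "\<And>t. t \<in> I \<Longrightarrow> (a has_real_derivative a' t) (at t within I)"
       "\<And>t. t \<in> I \<Longrightarrow> (a' has_real_derivative - f (a t)) (at t within I)" "a ` I \<subseteq> J"
    and b: "\<And>t. t \<in> I \<Longrightarrow> (b has_real_derivative b' t) (at t within I)"
       "\<And>t. t \<in> I \<Longrightarrow> (b' has_real_derivative - f (b t)) (at t within I)" "b ` I \<subseteq> J"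
    and init: "a t0 = b t0" "a' t0 = b' t0" and t: "t \<in> I"
  shows "a t = b t" "a' t = b' t"
proof -
  define N where "N = closed_segment t0 t"
  have NI: "N \<subseteq> I" unfolding N_def using I t
    by (simp add: closed_segment_subset is_interval_convex)
  define Z where "Z s = (a s - b s, a' s - b' s)" for s
  define Z' where "Z' s = (a' s - b' s, - f (a s) - - f (b s))" for s
  have cont: "continuous_on N a" "continuous_on N b"
    using a(1) b(1) NI by (meson DERIV_continuous_on continuous_on_subset)+
  have "compact (a ` N \<union> b ` N)"
    by (intro compact_Un compact_continuous_image cont) (simp_all add: N_def)
  moreover have "a ` N \<union> b ` N \<subseteq> J" using a(3) b(3) NI by blast
  ultimately obtain B where B: "B \<ge> 0"
    "\<And>s r. s \<in> a ` N \<union> b ` N \<Longrightarrow> r \<in> a ` N \<union> b ` N \<Longrightarrow> \<bar>f s - f r\<bar> \<le> B * \<bar>s - r\<bar>"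
    using C1_lipschitz_on_compact[OF J f f'] by metis
  have dZ: "(Z has_vector_derivative Z' s) (at s within N)" if "s \<in> N" for s
  proof -
    have s: "s \<in> I" using that NI by blast
    have "(Z has_vector_derivative Z' s) (at s within I)"
      unfolding Z_def Z'_def
      by (intro has_vector_derivative_Pair has_vector_derivative_diff)
        (use a(1,2)[OF s] b(1,2)[OF s] in \<open>auto simp: has_real_derivative_iff_has_vector_derivative\<close>)
    then show ?thesis using NI by (rule has_vector_derivative_within_subset)
  qed
  have "Z t = 0"
  proof (rule norm_bounded_derivative_imp_zero[of N Z t0 Z' "1 + B" t0 t])
    show "is_interval N" by (simp add: N_def is_interval_convex_1)
    show "continuous_on N Z" using dZ has_vector_derivative_continuous continuous_on_eq_continuous_within by blast
    show "norm (Z' s) \<le> (1 + B) * norm (Z s)" if "s \<in> N" for s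
    proof -
      have "\<bar>f (a s) - f (b s)\<bar> \<le> B * \<bar>a s - b s\<bar>" using B(2) that by blast
      moreover have "\<bar>a s - b s\<bar> \<le> norm (Z s)" "\<bar>a' s - b' s\<bar> \<le> norm (Z s)"
        using norm_fst_le[of "a s - b s" "a' s - b' s"] norm_snd_le[of "a' s - b' s" "a s - b s"]
        by (auto simp: Z_def)
      moreover have "norm (Z' s) \<le> \<bar>a' s - b' s\<bar> + \<bar>f (a s) - f (b s)\<bar>"
        using norm_Pair_le[of "a' s - b' s" "- f (a s) - - f (b s)"] by (simp add: Z'_def)
      ultimately show ?thesis
        using mult_left_mono[OF _ B(1), of "\<bar>a s - b s\<bar>" "norm (Z s)"] by (simp add: algebra_simps)
    qed
  qed (use dZ init in \<open>auto simp: N_def Z_def zero_prod_def\<close>)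
  then show "a t = b t" "a' t = b' t" by (auto simp: Z_def zero_prod_def)
qed

lemma connected_space_locally_constant:
  assumes X: "connected_space X" and p: "p \<in> topspace X" "P p" and q: "q \<in> topspace X"
    and loc: "\<And>x. x \<in> topspace X \<Longrightarrow> \<exists>N. openin X N \<and> x \<in> N \<and> (\<forall>a\<in>N. \<forall>b\<in>N. P a \<longrightarrow> P b)"
  shows "P q"
proof -
  define S where "S = {x \<in> topspace X. P x}"
  have "openin X S"
    unfolding openin_subopen[of X S]
  proof
    fix x assume "x \<in> S"
    with loc[of x] obtain N where N: "openin X N" "x \<in> N" "\<forall>a\<in>N. \<forall>b\<in>N. P a \<longrightarrow> P b" by (auto simp: S_def)
    then have "N \<subseteq> S" using \<open>x \<in> S\<close> openin_subset[OF N(1)] unfolding S_def by blast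
    then show "\<exists>T. openin X T \<and> x \<in> T \<and> T \<subseteq> S" using N by blast
  qed
  moreover have "openin X (topspace X - S)"
    unfolding openin_subopen[of X "topspace X - S"]
  proof
    fix x assume x: "x \<in> topspace X - S"
    with loc[of x] obtain N where N: "openin X N" "x \<in> N" "\<forall>a\<in>N. \<forall>b\<in>N. P a \<longrightarrow> P b" by auto
    then have "N \<subseteq> topspace X - S" using x openin_subset[OF N(1)] unfolding S_def by blast
    then show "\<exists>T. openin X T \<and> x \<in> T \<and> T \<subseteq> topspace X - S" using N by blast
  qed
  moreover have "S \<subseteq> topspace X" by (auto simp: S_def)
  ultimately have "S = {} \<or> S = topspace X"
    using X unfolding connected_space_clopen_in closedin_def by blast
  then show ?thesis using p q by (auto simp: S_def)
qed

lemma sum_axis_axis: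
  fixes H :: "'n::finite \<Rightarrow> 'n \<Rightarrow> real"
  shows "(\<Sum>i\<in>UNIV. \<Sum>j\<in>UNIV. H i j * axis a 1 $ i * axis b 1 $ j) = H a b"
  by (simp add: axis_def if_distrib[of "\<lambda>y. _ * y"] cong: if_cong)

lemma critical_point_iff:
  assumes M: "smooth_manifold M" and w: "smooth_fun M w" and c: "c \<in> charts_at M p"
  shows "critical_point M w p \<longleftrightarrow> (\<forall>k. pderiv_at k (w \<circ> chart_inv c) (snd c p) = 0)"
proof
  assume "critical_point M w p"
  then show "\<forall>k. pderiv_at k (w \<circ> chart_inv c) (snd c p) = 0"
    using c by (simp add: critical_point_def pderiv_at_def)
next
  assume 0: "\<forall>k. pderiv_at k (w \<circ> chart_inv c) (snd c p) = 0"
  have dw: "(w \<circ> chart_inv d) differentiable (at (snd d p))" if "d \<in> charts_at M p" for d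
    using w that by (intro smooth_on_imp_differentiable[of "snd d ` fst d"]) (auto simp: smooth_fun_def charts_at_def)
  have c0: "((w \<circ> chart_inv c) has_derivative (\<lambda>_. 0)) (at (snd c p))"
    using has_derivative_sum_pderiv[OF dw[OF c]] 0 by simp
  have "frechet_derivative (w \<circ> chart_inv d) (at (snd d p)) = (\<lambda>_. 0)" if "d \<in> charts_at M p" for d
    using frechet_derivative_at[OF has_derivative_change_chart[OF M that c c0]] by simp
  moreover have "p \<in> pts M" using c atlas_props(4)[OF M, of c] unfolding charts_at_def by blast
  ultimately show "critical_point M w p" by (simp add: critical_point_def)
qed

lemma openin_chart_vimage:
  assumes M: "smooth_manifold M" and c: "c \<in> atlas M" and B: "open B"
  shows "openin (top_of M) {q \<in> fst c. snd c q \<in> B}"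
proof -
  have "continuous_map (subtopology (top_of M) (fst c)) (top_of_set (snd c ` fst c)) (snd c)"
    using atlas_props(3)[OF M c] homeomorphic_imp_continuous_map by blast
  then have "continuous_map (subtopology (top_of M) (fst c)) euclidean (snd c)"
    by (simp add: continuous_map_in_subtopology)
  then have "openin (subtopology (top_of M) (fst c)) {q \<in> topspace (subtopology (top_of M) (fst c)). snd c q \<in> B}"
    using B by (rule_tac openin_continuous_map_preimage) auto
  moreover have "topspace (subtopology (top_of M) (fst c)) = fst c"
    using atlas_props(4)[OF M c] by (auto simp: topspace_subtopology)
  ultimately show ?thesis
    using atlas_props(1)[OF M c] openin_trans_full by fastforce
qed

lemma (in riem_chart) hessian_obata:
  assumes ob: "obata_solution M f w" and x: "x \<in> U"
  shows "pderiv_at i (pderiv_at j (w \<circ> chart_inv c)) x =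
     (\<Sum>k\<in>UNIV. \<Gamma> k i j x * pderiv_at k (w \<circ> chart_inv c) x) - f ((w \<circ> chart_inv c) x) * g i j x"
proof -
  define p where "p = chart_inv c x"
  have px: "snd c p = x" using chart_inv_simps(2)[OF smooth_mfd chart x] by (simp add: p_def)
  have cp: "c \<in> charts_at M p" using chart_at[OF x] by (simp add: p_def)
  have p: "p \<in> pts M" using chart_inv_simps(3)[OF smooth_mfd chart x] atlas_props(4)[OF smooth_mfd chart] by (auto simp: p_def)
  note T = tvec_of_in_tangent_space[OF smooth_mfd cp]
  have "hessian M w c p (tvec_of M c p (axis i 1)) (tvec_of M c p (axis j 1))
      + f (w p) * metric M p (tvec_of M c p (axis i 1)) (tvec_of M c p (axis j 1)) = 0"
    using ob p cp T unfolding obata_solution_def by blast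
  then show ?thesis
    unfolding metric_in_chart[OF riem cp T T] hessian_def tvec_of_component[OF smooth_mfd cp] sum_axis_axis px
    by (simp add: hessian_coeff_def p_def)
qed

lemma (in riem_chart) smooth_coordinate_function:
  assumes "smooth_fun M w" shows "smooth_on U (w \<circ> chart_inv c)"
  using assms chart by (simp add: smooth_fun_def)

lemma continuous_on_bounded_above_Icc:
  fixes K :: "real \<Rightarrow> real"
  assumes "continuous_on {a..b} K"
  obtains B where "\<And>t. t \<in> {a..b} \<Longrightarrow> K t \<le> B"
proof -
  have "bounded (K ` {a..b})"
    using compact_continuous_image[OF assms] compact_imp_bounded by blast
  then show ?thesis
    using that unfolding bounded_real by (metis abs_le_D1 imageI)
qed

text \<open>Along the segment from \<open>x\<close> to \<open>y\<close> the pair \<open>(h - \<mu>, dh)\<close> satisfies a first order system,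
  by the Hessian equation. As \<open>f(\<mu>) = 0\<close> and \<open>f\<close> is Lipschitz, \<open>\<bar>f(h)\<bar> \<le> B \<bar>h - \<mu>\<bar>\<close>, so the derivative
  of the pair is bounded by a multiple of the pair itself.\<close>

lemma (in riem_chart) critical_value_propagates:
  assumes ob: "obata_solution M f w" and J: "is_interval J" "w ` pts M \<subseteq> J"
    and f: "\<And>s. s \<in> J \<Longrightarrow> (f has_real_derivative f' s) (at s within J)" "continuous_on J f'"
    and f\<mu>: "f \<mu> = 0"
    and C: "convex C" "C \<subseteq> U" "x \<in> C" "y \<in> C"
    and x: "(w \<circ> chart_inv c) x = \<mu>" "\<And>k. pderiv_at k (w \<circ> chart_inv c) x = 0"
  shows "(w \<circ> chart_inv c) y = \<mu>" "pderiv_at k (w \<circ> chart_inv c) y = 0"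
proof -
  define h where "h = w \<circ> chart_inv c"
  define v where "v = y - x"
  define \<xi> where "\<xi> t = x + t *\<^sub>R v" for t :: real
  have \<xi>U: "\<xi> t \<in> U" if "t \<in> {0..1}" for t
  proof -
    have "\<xi> t = (1 - t) *\<^sub>R x + t *\<^sub>R y" by (simp add: \<xi>_def v_def algebra_simps)
    also have "\<dots> \<in> C" using convexD_alt[OF C(1,3,4)] that by auto
    finally show ?thesis using C(2) by auto
  qed
  have d\<xi>: "(\<xi> has_vector_derivative v) (at t within {0..1})" for t
    unfolding \<xi>_def by (auto intro!: derivative_eq_intros)
  have c\<xi>: "continuous_on {0..1} \<xi>" unfolding \<xi>_def by (intro continuous_intros)
  have smooth: "smooth_on U h"
    unfolding h_def using ob by (intro smooth_coordinate_function) (simp add: obata_solution_def)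
  have dh: "h differentiable (at z)" "pderiv_at k h differentiable (at z)" if "z \<in> U" for z k
    using smooth_on_imp_differentiable[OF smooth that] smooth_on_imp_differentiable[OF smooth_on_pderiv[OF smooth] that] .
  have hJ: "h z \<in> J" if "z \<in> U" for z
    using chart_inv_simps(3)[OF smooth_mfd chart that] atlas_props(4)[OF smooth_mfd chart] J(2)
    by (auto simp: h_def)
  have hess: "pderiv_at i (pderiv_at j h) z = (\<Sum>k\<in>UNIV. \<Gamma> k i j z * pderiv_at k h z) - f (h z) * g i j z"
    if "z \<in> U" for z i j
    unfolding h_def by (rule hessian_obata[OF ob that])
  have cont: "continuous_on {0..1} (\<lambda>t. F (\<xi> t))" if "\<And>z. z \<in> U \<Longrightarrow> F differentiable (at z)" for F :: "real ^ 'n \<Rightarrow> real"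
  proof (rule continuous_on_compose2[OF _ c\<xi>])
    show "continuous_on U F"
      using that by (intro differentiable_imp_continuous_on) (simp add: differentiable_on_def differentiable_at_withinI)
  qed (use \<xi>U in auto)
  define Cp where "Cp = insert \<mu> ((\<lambda>t. h (\<xi> t)) ` {0..1})"
  have "compact Cp" unfolding Cp_def by (intro compact_insert compact_continuous_image cont dh) auto
  moreover have \<mu>J: "\<mu> \<in> J" using hJ[of x] C x by (auto simp: h_def)
  then have "Cp \<subseteq> J" using hJ \<xi>U by (auto simp: Cp_def)
  ultimately obtain B where B: "B \<ge> 0" "\<And>s r. s \<in> Cp \<Longrightarrow> r \<in> Cp \<Longrightarrow> \<bar>f s - f r\<bar> \<le> B * \<bar>s - r\<bar>"
    using C1_lipschitz_on_compact[OF J(1) f] by metis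
  define b where "b t = (\<chi> k. pderiv_at k h (\<xi> t))" for t
  define b' where "b' t = (\<chi> j. \<Sum>i\<in>UNIV. v $ i * pderiv_at i (pderiv_at j h) (\<xi> t))" for t
  define Z where "Z t = (h (\<xi> t) - \<mu>, b t)" for t
  define Z' where "Z' t = (\<Sum>i\<in>UNIV. v $ i * pderiv_at i h (\<xi> t), b' t)" for t
  define K where "K t = (\<Sum>i\<in>UNIV. \<bar>v $ i\<bar>) + (\<Sum>j\<in>UNIV. \<Sum>i\<in>UNIV. \<bar>v $ i\<bar> *
      ((\<Sum>k\<in>UNIV. \<bar>\<Gamma> k i j (\<xi> t)\<bar>) + B * \<bar>g i j (\<xi> t)\<bar>))" for t
  have "continuous_on {0..1} K"
    unfolding K_def by (intro continuous_intros cont differentiable_christoffel differentiable_g)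
  then obtain K0 where K0: "\<And>t. t \<in> {0..1} \<Longrightarrow> K t \<le> K0" using continuous_on_bounded_above_Icc by blast
  have dZ: "(Z has_vector_derivative Z' t) (at t within {0..1})" if "t \<in> {0..1}" for t
  proof -
    note ch = has_vector_derivative_chain_pderiv[OF d\<xi>, unfolded has_real_derivative_iff_has_vector_derivative]
    have "((\<lambda>t. h (\<xi> t) - \<mu>) has_vector_derivative (\<Sum>i\<in>UNIV. v $ i * pderiv_at i h (\<xi> t))) (at t within {0..1})"
      using has_vector_derivative_diff[OF ch[OF dh(1)[OF \<xi>U[OF that]]] has_vector_derivative_const[of \<mu>]] by simp
    moreover have "(b has_vector_derivative b' t) (at t within {0..1})"
      unfolding has_vector_derivative_def has_derivative_componentwise_within[of b]
    proof
      fix e :: "real ^ 'n" assume "e \<in> Basis"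
      then obtain j where e: "e = axis j 1" by (auto simp: Basis_vec_def)
      show "((\<lambda>s. b s \<bullet> e) has_derivative (\<lambda>s. (s *\<^sub>R b' t) \<bullet> e)) (at t within {0..1})"
        using ch[OF dh(2)[OF \<xi>U[OF that]], of j]
        unfolding has_vector_derivative_def by (simp add: e b_def b'_def inner_axis)
    qed
    ultimately show ?thesis unfolding Z_def Z'_def by (rule has_vector_derivative_Pair)
  qed
  have bound: "norm (Z' t) \<le> K0 * norm (Z t)" if t: "t \<in> {0..1}" for t
  proof -
    let ?n = "norm (Z t)"
    have pb: "\<bar>pderiv_at k h (\<xi> t)\<bar> \<le> ?n" for k
      using component_le_norm_cart[of "b t" k] norm_snd_le[of "b t" "h (\<xi> t) - \<mu>"] by (simp add: b_def Z_def)
    have "h (\<xi> t) \<in> Cp" "\<mu> \<in> Cp" using t by (auto simp: Cp_def)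
    then have "\<bar>f (h (\<xi> t))\<bar> \<le> B * \<bar>h (\<xi> t) - \<mu>\<bar>" using B(2)[of "h (\<xi> t)" \<mu>] f\<mu> by simp
    also have "\<dots> \<le> B * ?n"
      using norm_fst_le[of "h (\<xi> t) - \<mu>" "b t"] B(1) by (intro mult_left_mono) (auto simp: Z_def)
    finally have fb: "\<bar>f (h (\<xi> t))\<bar> \<le> B * ?n" .
    have 1: "\<bar>\<Sum>i\<in>UNIV. v $ i * pderiv_at i h (\<xi> t)\<bar> \<le> (\<Sum>i\<in>UNIV. \<bar>v $ i\<bar>) * ?n"
      unfolding sum_distrib_right
      by (rule order_trans[OF sum_abs sum_mono]) (simp add: abs_mult mult_left_mono pb)
    have hb: "\<bar>pderiv_at i (pderiv_at j h) (\<xi> t)\<bar> \<le> ((\<Sum>k\<in>UNIV. \<bar>\<Gamma> k i j (\<xi> t)\<bar>) + B * \<bar>g i j (\<xi> t)\<bar>) * ?n" for i j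
    proof -
      have "\<bar>\<Sum>k\<in>UNIV. \<Gamma> k i j (\<xi> t) * pderiv_at k h (\<xi> t)\<bar> \<le> (\<Sum>k\<in>UNIV. \<bar>\<Gamma> k i j (\<xi> t)\<bar>) * ?n"
        unfolding sum_distrib_right
        by (rule order_trans[OF sum_abs sum_mono]) (simp add: abs_mult mult_left_mono pb)
      moreover have "\<bar>f (h (\<xi> t)) * g i j (\<xi> t)\<bar> \<le> B * \<bar>g i j (\<xi> t)\<bar> * ?n"
        using mult_right_mono[OF fb abs_ge_zero, of "g i j (\<xi> t)"] by (simp add: abs_mult mult_ac)
      ultimately show ?thesis unfolding hess[OF \<xi>U[OF t]] distrib_right by linarith
    qed
    have "norm (b' t) \<le> (\<Sum>j\<in>UNIV. \<bar>b' t $ j\<bar>)" by (rule norm_le_l1_cart)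
    also have "\<dots> \<le> (\<Sum>j\<in>UNIV. \<Sum>i\<in>UNIV. \<bar>v $ i\<bar> * (((\<Sum>k\<in>UNIV. \<bar>\<Gamma> k i j (\<xi> t)\<bar>) + B * \<bar>g i j (\<xi> t)\<bar>) * ?n))"
    proof (rule sum_mono)
      fix j
      show "\<bar>b' t $ j\<bar> \<le> (\<Sum>i\<in>UNIV. \<bar>v $ i\<bar> * (((\<Sum>k\<in>UNIV. \<bar>\<Gamma> k i j (\<xi> t)\<bar>) + B * \<bar>g i j (\<xi> t)\<bar>) * ?n))"
        unfolding b'_def vec_lambda_beta
        by (rule order_trans[OF sum_abs sum_mono]) (simp only: abs_mult mult_left_mono hb abs_ge_zero)
    qed
    finally have 2: "norm (b' t) \<le> (\<Sum>j\<in>UNIV. \<Sum>i\<in>UNIV. \<bar>v $ i\<bar> *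
      ((\<Sum>k\<in>UNIV. \<bar>\<Gamma> k i j (\<xi> t)\<bar>) + B * \<bar>g i j (\<xi> t)\<bar>)) * ?n"
      unfolding sum_distrib_right mult.assoc .
    have "norm (Z' t) \<le> K t * ?n"
      using norm_Pair_le[of "\<Sum>i\<in>UNIV. v $ i * pderiv_at i h (\<xi> t)" "b' t"] 1 2
      unfolding Z'_def K_def distrib_right real_norm_def by linarith
    also have "\<dots> \<le> K0 * ?n" using K0[OF t] by (intro mult_right_mono) auto
    finally show ?thesis .
  qed
  have "Z 1 = 0"
  proof (rule norm_bounded_derivative_imp_zero[of "{0..1}" Z 0 Z' K0 0 1])
    show "continuous_on {0..1} Z" using dZ has_vector_derivative_continuous continuous_on_eq_continuous_within by blast
    show "Z 0 = 0" using x by (simp add: Z_def \<xi>_def b_def h_def vec_eq_iff zero_prod_def)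
  qed (use dZ bound in \<open>auto simp: is_interval_cc\<close>)
  then have "h y = \<mu>" "b 1 = 0" by (auto simp: Z_def \<xi>_def v_def zero_prod_def)
  then show "(w \<circ> chart_inv c) y = \<mu>" "pderiv_at k (w \<circ> chart_inv c) y = 0"
    by (auto simp: h_def b_def \<xi>_def v_def vec_eq_iff)
qed

text \<open>If \<open>f\<close> vanished at the critical value, being a critical point with this value would be a
  locally constant property, hence shared by all points of the connected manifold.\<close>

lemma obata_critical_value_nondegenerate:
  assumes R: "riemannian_manifold M" and conn: "connected_space (top_of M)"
    and J: "is_interval J" "w ` pts M \<subseteq> J"
    and f: "\<And>s. s \<in> J \<Longrightarrow> (f has_real_derivative f' s) (at s within J)" "continuous_on J f'"
    and ob: "obata_solution M f w" and nc: "\<not> (\<exists>k. \<forall>p\<in>pts M. w p = k)"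
    and crit: "critical_point M w p0"
  shows "f (w p0) \<noteq> 0"
proof
  assume f0: "f (w p0) = 0"
  have M: "smooth_manifold M" using R by (simp add: riemannian_manifold_def)
  have sw: "smooth_fun M w" using ob by (simp add: obata_solution_def)
  let ?P = "\<lambda>p. w p = w p0 \<and> critical_point M w p"
  have "?P q" if q: "q \<in> pts M" for q
  proof (rule connected_space_locally_constant[OF conn, of p0 ?P q])
    show "p0 \<in> pts M" using crit by (simp add: critical_point_def)
  next
    fix p assume "p \<in> pts M"
    then obtain c where c: "c \<in> atlas M" "p \<in> fst c" using M unfolding smooth_manifold_def by blast
    interpret riem_chart M c using R c by unfold_locales
    obtain r where r: "r > 0" "ball (snd c p) r \<subseteq> U" using open_U c openE by blast
    define N where "N = {q \<in> fst c. snd c q \<in> ball (snd c p) r}"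
    have "?P b" if "a \<in> N" "b \<in> N" "?P a" for a b
    proof -
      have ca: "c \<in> charts_at M a" "c \<in> charts_at M b" using that c by (auto simp: N_def charts_at_def)
      have ia: "chart_inv c (snd c a) = a" "chart_inv c (snd c b) = b"
        using that chart_inv_simps(1)[OF smooth_mfd chart] by (auto simp: N_def)
      have *: "(w \<circ> chart_inv c) (snd c a) = w p0" "pderiv_at k (w \<circ> chart_inv c) (snd c a) = 0" for k
        using that(3) ia critical_point_iff[OF M sw ca(1)] by auto
      have "snd c a \<in> ball (snd c p) r" "snd c b \<in> ball (snd c p) r" using that by (auto simp: N_def)
      note at_b = critical_value_propagates[OF ob J f f0 convex_ball r(2) this *]
      show ?thesis using at_b ia critical_point_iff[OF M sw ca(2)] by simp
    qed
    moreover have "openin (top_of M) N" unfolding N_def by (rule openin_chart_vimage[OF M c(1) open_ball])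
    moreover have "p \<in> N" using c r by (simp add: N_def)
    ultimately show "\<exists>N. openin (top_of M) N \<and> p \<in> N \<and> (\<forall>a\<in>N. \<forall>b\<in>N. ?P a \<longrightarrow> ?P b)" by blast
  qed (use crit q in auto)
  then show False using nc by blast
qed

section \<open>Curves in a chart\<close>

lemma proper_interval_not_bot:
  assumes "proper_interval I" "t \<in> I"
  shows "at t within I \<noteq> bot"
proof -
  from assms obtain a b where ab: "a \<in> I" "b \<in> I" "a < b" by (auto simp: proper_interval_def)
  have "t islimpt I"
    using assms ab by (intro connected_imp_perfect) (auto simp: proper_interval_def is_interval_connected)
  then show ?thesis by (simp add: trivial_limit_within)
qed

lemma has_vector_derivative_cong_openin:
  assumes "openin (top_of_set I) T" "t \<in> T" "\<And>s. s \<in> T \<Longrightarrow> F s = G s"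
    and "(F has_vector_derivative D) (at t within I)"
  shows "(G has_vector_derivative D) (at t within I)"
proof -
  obtain d where d: "d > 0" "\<And>s. s \<in> I \<Longrightarrow> dist s t < d \<Longrightarrow> s \<in> T"
    using assms(1,2) unfolding openin_euclidean_subtopology_iff by blast
  have "t \<in> I" using assms(1,2) openin_imp_subset by blast
  then show ?thesis
    using has_vector_derivative_transform_within[OF assms(4) d(1)] d(2) assms(3) by blast
qed

lemma differentiable_vec_nth:
  assumes "F differentiable net" shows "(\<lambda>s. F s $ i) differentiable net"
  using assms bounded_linear.has_derivative[OF bounded_linear_vec_nth] unfolding differentiable_def by blast

lemma differentiable_vec_componentwise:
  fixes F :: "real \<Rightarrow> 'a::euclidean_space ^ 'n::finite"
  assumes "\<And>i. (\<lambda>s. F s $ i) differentiable (at t within I)"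
  shows "F differentiable (at t within I)"
proof -
  have "(\<lambda>s. F s \<bullet> axis i b) differentiable (at t within I)" for i b
    using differentiable_inner[OF assms[of i] differentiable_const[of b]] by (simp add: inner_axis)
  then show ?thesis
    unfolding differentiable_componentwise_within[of F] by (auto simp: Basis_vec_def)
qed

lemma norm_matrix_vector_mult_le:
  fixes A :: "real ^ 'n ^ 'm::finite"
  shows "norm (A *v x) \<le> (\<Sum>i\<in>UNIV. \<Sum>j\<in>UNIV. \<bar>A $ i $ j\<bar>) * norm x"
  using onorm[OF matrix_vector_mul_bounded_linear[of A], of x]
    mult_right_mono[OF onorm_le_matrix_component_sum[of A] norm_ge_zero[of x]] by linarith

text \<open>The connection pulled back to the curve: in a chart, covariant differentiation of a field
  along \<open>\<gamma>\<close> is the ordinary derivative plus multiplication by this matrix.\<close>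

definition connection_matrix ::
    "('m, 'n::finite) riem \<Rightarrow> real set \<Rightarrow> (real \<Rightarrow> 'm) \<Rightarrow> ('m, 'n) chart \<Rightarrow> real \<Rightarrow> real ^ 'n ^ 'n"
  where "connection_matrix M I \<gamma> c t =
    (\<chi> k j. \<Sum>i\<in>UNIV. christoffel M c k i j (snd c (\<gamma> t)) * velocity M I \<gamma> t c $ i)"

lemma cov_deriv_eq_connection_matrix:
  assumes "c \<in> charts_at M (\<gamma> t)"
  shows "cov_deriv M I \<gamma> X t c =
    vector_derivative (\<lambda>s. X s c) (at t within I) + connection_matrix M I \<gamma> c t *v X t c"
proof -
  have "(\<chi> k. \<Sum>i\<in>UNIV. \<Sum>j\<in>UNIV.
      christoffel M c k i j (snd c (\<gamma> t)) * velocity M I \<gamma> t c $ i * X t c $ j) =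
      connection_matrix M I \<gamma> c t *v X t c"
    by (subst sum.swap)
      (simp add: vec_eq_iff matrix_vector_mult_def connection_matrix_def sum_distrib_right)
  then show ?thesis using assms by (simp add: cov_deriv_def)
qed

locale curve_chart = riem_chart M c for M :: "('m, 'n::finite) riem" and c +
  fixes I :: "real set" and \<gamma> :: "real \<Rightarrow> 'm"
  assumes proper: "proper_interval I" and geo: "geodesic M I \<gamma>"
begin

definition T where "T = {t \<in> I. \<gamma> t \<in> fst c}"
definition \<xi> where "\<xi> t = snd c (\<gamma> t)"
definition vel where "vel t = velocity M I \<gamma> t c"
abbreviation A where "A \<equiv> connection_matrix M I \<gamma> c"

lemma T_in: "t \<in> T \<Longrightarrow> t \<in> I" "t \<in> T \<Longrightarrow> c \<in> charts_at M (\<gamma> t)" "t \<in> T \<Longrightarrow> \<xi> t \<in> U"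
  "t \<in> T \<Longrightarrow> chart_inv c (\<xi> t) = \<gamma> t"
  using chart chart_inv_simps(1)[OF smooth_mfd chart] by (auto simp: T_def \<xi>_def charts_at_def)

lemma smooth_\<gamma>: "smooth_curve M I \<gamma>"
  using geo by (simp add: geodesic_def)

lemma openin_T: "openin (top_of_set I) T"
proof -
  have "continuous_map (top_of_set I) (top_of M) \<gamma>" using smooth_\<gamma> by (simp add: smooth_curve_def)
  then have "openin (top_of_set I) {t \<in> topspace (top_of_set I). \<gamma> t \<in> fst c}"
    by (rule openin_continuous_map_preimage) (rule atlas_props(1)[OF smooth_mfd chart])
  then show ?thesis by (simp add: T_def)
qed

lemma iter_deriv_\<xi>: "t \<in> T \<Longrightarrow> iter_deriv I k \<xi> differentiable (at t within I)"
proof -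
  have "smooth_within I T (snd c \<circ> \<gamma>)"
    using smooth_\<gamma> chart by (simp add: smooth_curve_def T_def)
  moreover have "snd c \<circ> \<gamma> = \<xi>" by (auto simp: \<xi>_def)
  ultimately show "t \<in> T \<Longrightarrow> ?thesis" by (simp add: smooth_within_def)
qed

lemma vel_eq: "t \<in> T \<Longrightarrow> vel t = iter_deriv I 1 \<xi> t"
  using T_in by (simp add: vel_def velocity_def \<xi>_def[abs_def] o_def)

lemma \<xi>_derivative: "t \<in> T \<Longrightarrow> (\<xi> has_vector_derivative vel t) (at t within I)"
  using iter_deriv_\<xi>[of t 0] vector_derivative_works[of \<xi> "at t within I"] by (simp add: vel_eq)

lemma vel_differentiable: "t \<in> T \<Longrightarrow> vel differentiable (at t within I)"
proof -
  assume t: "t \<in> T"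
  have "(vel has_vector_derivative vector_derivative (iter_deriv I 1 \<xi>) (at t within I)) (at t within I)"
    by (rule has_vector_derivative_cong_openin[OF openin_T t, of "iter_deriv I 1 \<xi>"])
      (simp_all only: vel_eq vector_derivative_works[symmetric] iter_deriv_\<xi>[OF t])
  then show ?thesis by (auto simp: differentiable_def has_vector_derivative_def)
qed

lemma field_derivative:
  assumes t: "t \<in> T" and X: "(\<lambda>s. X s c) differentiable (at t within I)"
  shows "((\<lambda>s. X s c) has_vector_derivative cov_deriv M I \<gamma> X t c - A t *v X t c) (at t within I)"
  using X[unfolded vector_derivative_works] cov_deriv_eq_connection_matrix[where \<gamma> = \<gamma> and t = t and X = X, OF T_in(2)[OF t]] by simp

lemma vel_derivative: "t \<in> T \<Longrightarrow> (vel has_vector_derivative - (A t *v vel t)) (at t within I)"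
  using field_derivative[of t "velocity M I \<gamma>"] vel_differentiable[of t] geo T_in(1)[of t]
  by (simp add: vel_def[abs_def] geodesic_def)

lemma differentiable_along:
  fixes F :: "real ^ 'n \<Rightarrow> real"
  assumes "t \<in> T" "F differentiable (at (\<xi> t))"
  shows "(\<lambda>s. F (\<xi> s)) differentiable (at t within I)"
  using has_vector_derivative_chain_pderiv[OF \<xi>_derivative[OF assms(1)] assms(2)]
  by (auto simp: differentiable_def has_field_derivative_def)

lemma differentiable_connection:
  assumes t: "t \<in> T" shows "A differentiable (at t within I)"
proof (intro differentiable_vec_componentwise)
  fix k j
  have "(\<lambda>s. vel s $ i) differentiable (at t within I)" for i
    by (rule differentiable_vec_nth[OF vel_differentiable[OF t]])
  then show "(\<lambda>s. A s $ k $ j) differentiable (at t within I)"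
    using differentiable_along[OF t differentiable_christoffel[OF T_in(3)[OF t]]]
    unfolding connection_matrix_def vel_def \<xi>_def
    by (simp add: differentiable_sum_fun)
qed

text \<open>A bound for the operator norm of the connection matrix whose continuity is evident.\<close>

definition Abound where "Abound t = (\<Sum>i\<in>UNIV. \<Sum>j\<in>UNIV. \<bar>A t $ i $ j\<bar>)"

lemma continuous_Abound: "t \<in> T \<Longrightarrow> continuous (at t within I) Abound"
proof -
  assume "t \<in> T"
  from differentiable_imp_continuous_within[OF differentiable_connection[OF this]]
  show ?thesis
    unfolding Abound_def continuous_within
    by (intro tendsto_sum tendsto_rabs tendsto_vec_nth)
qed

lemma norm_A_le: "norm (A t *v x) \<le> Abound t * norm x"
  unfolding Abound_def by (rule norm_matrix_vector_mult_le)

end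

lemma velocity_in_tangent_space:
  assumes R: "riemannian_manifold M" and I: "proper_interval I" and geo: "geodesic M I \<gamma>" and t: "t \<in> I"
  shows "velocity M I \<gamma> t \<in> tangent_space M (\<gamma> t)"
  unfolding tangent_space_def
proof (intro CollectI conjI ballI allI impI)
  fix c d assume c: "c \<in> charts_at M (\<gamma> t)" and d: "d \<in> charts_at M (\<gamma> t)"
  have M: "smooth_manifold M" using R by (simp add: riemannian_manifold_def)
  interpret C: curve_chart M c I \<gamma> using R I geo c by unfold_locales (auto simp: charts_at_def)
  interpret D: curve_chart M d I \<gamma> using R I geo d by unfold_locales (auto simp: charts_at_def)
  have tC: "t \<in> C.T" and tD: "t \<in> D.T" using c d t by (auto simp: C.T_def D.T_def charts_at_def)
  have "((\<lambda>s. (snd d \<circ> chart_inv c) (C.\<xi> s)) has_derivative (\<lambda>h. coord_change_deriv c d (\<gamma> t) (h *\<^sub>R C.vel t))) (at t within I)"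
    using has_derivative_compose[OF C.\<xi>_derivative[OF tC, unfolded has_vector_derivative_def]
      coord_change_has_derivative[OF M c d, folded C.\<xi>_def]] .
  moreover have "linear (coord_change_deriv c d (\<gamma> t))"
    using coord_change_has_derivative[OF M c d] has_derivative_bounded_linear bounded_linear.linear by blast
  ultimately have "((\<lambda>s. (snd d \<circ> chart_inv c) (C.\<xi> s)) has_vector_derivative coord_change_deriv c d (\<gamma> t) (C.vel t)) (at t within I)"
    by (simp add: has_vector_derivative_def linear_cmul)
  then have "(D.\<xi> has_vector_derivative coord_change_deriv c d (\<gamma> t) (C.vel t)) (at t within I)"
    by (rule has_vector_derivative_cong_openin[OF C.openin_T tC, rotated]) (simp add: C.T_in D.\<xi>_def)
  from vector_derivative_unique_within[OF proper_interval_not_bot[OF I t] D.\<xi>_derivative[OF tD] this]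
  show "velocity M I \<gamma> t d = coord_change_deriv c d (\<gamma> t) (velocity M I \<gamma> t c)"
    by (simp add: C.vel_def D.vel_def)
qed (simp add: velocity_def)

text \<open>For a tangent vector \<open>X\<close>, the equation \<open>W = r X\<close> is equivalent to
  \<open>dw(Z) = r g(Z, X)\<close> for all tangent vectors \<open>Z\<close>, and the latter form does not refer to a chart.\<close>

lemma gradient_proportional_change_chart:
  assumes R: "riemannian_manifold M" and w: "smooth_fun M w" and c: "c \<in> charts_at M p" and d: "d \<in> charts_at M p"
    and X: "X \<in> tangent_space M p"
    and eq: "\<And>i. gradient_coeff M c (w \<circ> chart_inv c) i (snd c p) = r * X c $ i"
  shows "gradient_coeff M d (w \<circ> chart_inv d) i (snd d p) = r * X d $ i"
proof -
  have M: "smooth_manifold M" using R by (simp add: riemannian_manifold_def)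
  interpret C: riem_chart M c using R c by unfold_locales (auto simp: charts_at_def)
  interpret D: riem_chart M d using R d by unfold_locales (auto simp: charts_at_def)
  have xC: "snd c p \<in> C.U" and xD: "snd d p \<in> D.U" using c d by (auto simp: charts_at_def)
  have hc: "(w \<circ> chart_inv c) differentiable (at (snd c p))"
    by (rule smooth_on_imp_differentiable[OF C.smooth_coordinate_function[OF w] xC])
  have dw: "(\<Sum>k\<in>UNIV. Z d $ k * pderiv_at k (w \<circ> chart_inv d) (snd d p)) = r * metric M p Z X"
    if Z: "Z \<in> tangent_space M p" for Z
  proof -
    have hd: "(w \<circ> chart_inv d) differentiable (at (snd d p))"
      by (rule smooth_on_imp_differentiable[OF D.smooth_coordinate_function[OF w] xD])
    have Zc: "Z c = coord_change_deriv d c p (Z d)" using Z c d unfolding tangent_space_def by blast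
    have "(\<Sum>k\<in>UNIV. Z d $ k * pderiv_at k (w \<circ> chart_inv d) (snd d p)) =
        (\<Sum>k\<in>UNIV. Z c $ k * pderiv_at k (w \<circ> chart_inv c) (snd c p))"
      using has_derivative_unique[OF has_derivative_sum_pderiv[OF hd]
          has_derivative_change_chart[OF M d c has_derivative_sum_pderiv[OF hc]]]
      unfolding Zc by (rule fun_cong)
    also have "\<dots> = (\<Sum>k\<in>UNIV. Z c $ k * (\<Sum>j\<in>UNIV. C.g k j (snd c p) * (r * X c $ j)))"
      by (simp add: C.lower_gradient[OF xC, symmetric] eq)
    also have "\<dots> = r * metric M p Z X"
      unfolding metric_in_chart[OF R c Z X] by (simp add: sum_distrib_left mult_ac)
    finally show ?thesis .
  qed
  have "pderiv_at k (w \<circ> chart_inv d) (snd d p) = (\<Sum>j\<in>UNIV. D.g k j (snd d p) * (r * X d $ j))" for k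
  proof -
    note T = tvec_of_in_tangent_space[OF M d, of "axis k 1"]
    have s: "(\<Sum>j\<in>UNIV. axis k 1 $ j * H j) = (H k :: real)" for H
      by (simp add: axis_def if_distrib[of "\<lambda>y. y * _"] cong: if_cong)
    have s2: "(\<Sum>i\<in>UNIV. \<Sum>j\<in>UNIV. D.g i j (snd d p) * axis k 1 $ i * X d $ j) =
       (\<Sum>i\<in>UNIV. axis k 1 $ i * (\<Sum>j\<in>UNIV. D.g i j (snd d p) * X d $ j))"
      by (simp add: sum_distrib_left mult_ac)
    show ?thesis
      using dw[OF T] unfolding metric_in_chart[OF R d T X] tvec_of_component[OF M d] s s2
      by (simp add: sum_distrib_left mult_ac)
  qed
  from D.raise_index[OF xD this[symmetric], of i]
  show ?thesis by (simp add: gradient_coeff_def)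
qed

section \<open>The solution along a geodesic\<close>

context curve_chart
begin

lemma vel_nth_derivative:
  "t \<in> T \<Longrightarrow> ((\<lambda>s. vel s $ i) has_real_derivative - (A t *v vel t) $ i) (at t within I)"
  using bounded_linear.has_vector_derivative[OF bounded_linear_vec_nth vel_derivative, of t i]
  by (simp add: has_real_derivative_iff_has_vector_derivative)

lemma connection_mult_nth: "(A t *v x) $ k = (\<Sum>i\<in>UNIV. \<Sum>j\<in>UNIV. \<Gamma> k j i (\<xi> t) * vel t $ j * x $ i)"
  by (simp add: connection_matrix_def matrix_vector_mult_def \<xi>_def vel_def sum_distrib_right)

definition dw_vel where
  "dw_vel w t = (\<Sum>i\<in>UNIV. vel t $ i * pderiv_at i (w \<circ> chart_inv c) (\<xi> t))"

lemma w_along_derivative: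
  assumes w: "smooth_fun M w" and t: "t \<in> T"
  shows "((\<lambda>s. w (\<gamma> s)) has_real_derivative dw_vel w t) (at t within I)"
proof -
  have "((\<lambda>s. (w \<circ> chart_inv c) (\<xi> s)) has_vector_derivative dw_vel w t) (at t within I)"
    unfolding dw_vel_def has_real_derivative_iff_has_vector_derivative[symmetric]
    by (intro has_vector_derivative_chain_pderiv[OF \<xi>_derivative[OF t]]
        smooth_on_imp_differentiable[OF smooth_coordinate_function[OF w]] T_in t)
  then show ?thesis
    unfolding has_real_derivative_iff_has_vector_derivative
    by (rule has_vector_derivative_cong_openin[OF openin_T t, rotated]) (simp add: T_in)
qed

text \<open>For a geodesic the second derivative of \<open>w \<circ> \<gamma>\<close> is the Hessian on the velocity: the
  Christoffel terms of the Hessian cancel against the acceleration.\<close>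

lemma dw_vel_derivative:
  assumes ob: "obata_solution M f w" and unit: "unit_speed M I \<gamma>" and t: "t \<in> T"
  shows "(dw_vel w has_real_derivative - f (w (\<gamma> t))) (at t within I)"
proof -
  define h where "h = w \<circ> chart_inv c"
  have w: "smooth_fun M w" using ob by (simp add: obata_solution_def)
  note tI = T_in[OF t]
  have hess: "pderiv_at i (pderiv_at j h) (\<xi> t) = (\<Sum>k\<in>UNIV. \<Gamma> k i j (\<xi> t) * pderiv_at k h (\<xi> t)) - f (w (\<gamma> t)) * g i j (\<xi> t)" for i j
    using hessian_obata[OF ob tI(3), of i j] tI(4) by (simp add: h_def)
  have V: "velocity M I \<gamma> t \<in> tangent_space M (\<gamma> t)"
    by (rule velocity_in_tangent_space[OF riem proper geo tI(1)])
  have "metric M (\<gamma> t) (velocity M I \<gamma> t) (velocity M I \<gamma> t) = 1"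
    using unit tI(1) by (simp add: unit_speed_def)
  then have one: "(\<Sum>i\<in>UNIV. \<Sum>j\<in>UNIV. g i j (\<xi> t) * vel t $ i * vel t $ j) = 1"
    unfolding metric_in_chart[OF riem tI(2) V V] by (simp add: \<xi>_def vel_def)
  have "((\<lambda>s. pderiv_at i h (\<xi> s)) has_real_derivative (\<Sum>j\<in>UNIV. vel t $ j * pderiv_at j (pderiv_at i h) (\<xi> t))) (at t within I)" for i
    unfolding h_def
    by (intro has_vector_derivative_chain_pderiv[OF \<xi>_derivative[OF t]]
        smooth_on_imp_differentiable[OF smooth_on_pderiv[OF smooth_coordinate_function[OF w]]] tI)
  from DERIV_mult[OF vel_nth_derivative[OF t] this]
  have "(dw_vel w has_real_derivative (\<Sum>i\<in>UNIV. - (A t *v vel t) $ i * pderiv_at i h (\<xi> t)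
      + (\<Sum>j\<in>UNIV. vel t $ j * pderiv_at j (pderiv_at i h) (\<xi> t)) * vel t $ i)) (at t within I)"
    unfolding dw_vel_def[abs_def] h_def[symmetric] by (intro DERIV_sum)
  moreover have "(\<Sum>i\<in>UNIV. (\<Sum>j\<in>UNIV. vel t $ j * pderiv_at j (pderiv_at i h) (\<xi> t)) * vel t $ i)
     = (\<Sum>i\<in>UNIV. (A t *v vel t) $ i * pderiv_at i h (\<xi> t)) - f (w (\<gamma> t))"
  proof -
    have "(\<Sum>i\<in>UNIV. (\<Sum>j\<in>UNIV. vel t $ j * pderiv_at j (pderiv_at i h) (\<xi> t)) * vel t $ i) =
      (\<Sum>i\<in>UNIV. \<Sum>j\<in>UNIV. \<Sum>k\<in>UNIV. \<Gamma> k j i (\<xi> t) * vel t $ j * vel t $ i * pderiv_at k h (\<xi> t))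
      - f (w (\<gamma> t)) * (\<Sum>i\<in>UNIV. \<Sum>j\<in>UNIV. g j i (\<xi> t) * vel t $ j * vel t $ i)"
      by (simp add: hess sum_distrib_left sum_distrib_right right_diff_distrib left_diff_distrib sum_subtractf mult_ac)
    also have "(\<Sum>i\<in>UNIV. \<Sum>j\<in>UNIV. g j i (\<xi> t) * vel t $ j * vel t $ i) = 1"
      using one by (subst sum.swap) simp
    also have "(\<Sum>i\<in>UNIV. \<Sum>j\<in>UNIV. \<Sum>k\<in>UNIV. \<Gamma> k j i (\<xi> t) * vel t $ j * vel t $ i * pderiv_at k h (\<xi> t))
       = (\<Sum>i\<in>UNIV. \<Sum>k\<in>UNIV. \<Sum>j\<in>UNIV. \<Gamma> k j i (\<xi> t) * vel t $ j * vel t $ i * pderiv_at k h (\<xi> t))"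
      by (intro sum.cong refl sum.swap)
    also have "\<dots> = (\<Sum>k\<in>UNIV. \<Sum>i\<in>UNIV. \<Sum>j\<in>UNIV. \<Gamma> k j i (\<xi> t) * vel t $ j * vel t $ i * pderiv_at k h (\<xi> t))"
      by (rule sum.swap)
    also have "\<dots> = (\<Sum>i\<in>UNIV. (A t *v vel t) $ i * pderiv_at i h (\<xi> t))"
      by (simp add: connection_mult_nth sum_distrib_right)
    finally show ?thesis by simp
  qed
  ultimately show ?thesis
    by (simp add: sum.distrib sum_negf sum_subtractf)
qed

end

locale obata_geodesic =
  fixes M :: "('m, 'n::finite) riem" and f f' u u' :: "real \<Rightarrow> real" and J I :: "real set"
    and w :: "'m \<Rightarrow> real" and \<gamma> :: "real \<Rightarrow> 'm"
  assumes R: "riemannian_manifold M"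
    and J: "is_interval J" "w ` pts M \<subseteq> J"
    and f: "\<And>s. s \<in> J \<Longrightarrow> (f has_real_derivative f' s) (at s within J)" "continuous_on J f'"
    and ob: "obata_solution M f w"
    and proper: "proper_interval I" and zero: "0 \<in> I"
    and geo: "geodesic M I \<gamma>" and unit: "unit_speed M I \<gamma>"
    and crit: "critical_point M w (\<gamma> 0)" and nondeg: "f (w (\<gamma> 0)) \<noteq> 0"
    and u: "u ` I \<subseteq> J" "\<And>t. t \<in> I \<Longrightarrow> (u has_real_derivative u' t) (at t within I)"
      "\<And>t. t \<in> I \<Longrightarrow> (u' has_real_derivative - f (u t)) (at t within I)"
    and init: "u 0 = w (\<gamma> 0)" "u' 0 = 0"
begin

lemma M: "smooth_manifold M"
  using R by (simp add: riemannian_manifold_def)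

lemma w: "smooth_fun M w"
  using ob by (simp add: obata_solution_def)

lemma interval_I: "is_interval I"
  using proper by (simp add: proper_interval_def)

lemma \<gamma>_in: "t \<in> I \<Longrightarrow> \<gamma> t \<in> pts M"
  using geo continuous_map_image_subset_topspace[of "top_of_set I" "top_of M" \<gamma>]
  by (auto simp: geodesic_def smooth_curve_def)

lemma obtain_chart:
  assumes "t \<in> I" obtains c where "c \<in> charts_at M (\<gamma> t)"
  using \<gamma>_in[OF assms] M unfolding smooth_manifold_def charts_at_def by blast

lemma curve_chart: "c \<in> charts_at M (\<gamma> t) \<Longrightarrow> curve_chart M c I \<gamma>"
  using R proper geo by unfold_locales (auto simp: charts_at_def)

lemma in_T: "t \<in> I \<Longrightarrow> c \<in> charts_at M (\<gamma> t) \<Longrightarrow> t \<in> curve_chart.T c I \<gamma>"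
  by (simp add: curve_chart.T_def[OF curve_chart[of c t]] charts_at_def)

text \<open>Both \<open>w \<circ> \<gamma>\<close> and \<open>u\<close> solve \<open>a'' + f(a) = 0\<close> with \<open>a(0) = \<mu>\<close> and \<open>a'(0) = 0\<close>.\<close>

lemma w_along:
  assumes t: "t \<in> I"
  shows "w (\<gamma> t) = u t" and "c \<in> charts_at M (\<gamma> t) \<Longrightarrow> curve_chart.dw_vel M c I \<gamma> w t = u' t"
proof -
  \<comment> \<open>A chart-free name for the derivative of \<open>w \<circ> \<gamma>\<close>, so that it can be differentiated on all of \<open>I\<close>.\<close>
  define a' where "a' s = vector_derivative (\<lambda>s. w (\<gamma> s)) (at s within I)" for s
  have a'_eq: "a' s = curve_chart.dw_vel M c I \<gamma> w s" if s: "s \<in> I" "c \<in> charts_at M (\<gamma> s)" for s c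
    unfolding a'_def
    using curve_chart.w_along_derivative[OF curve_chart[OF s(2)] w in_T[OF s]] proper_interval_not_bot[OF proper s(1)]
    by (simp add: vector_derivative_within has_real_derivative_iff_has_vector_derivative)
  have da: "((\<lambda>s. w (\<gamma> s)) has_real_derivative a' s) (at s within I)"
    and da': "(a' has_real_derivative - f (w (\<gamma> s))) (at s within I)" if s: "s \<in> I" for s
  proof -
    obtain c where c: "c \<in> charts_at M (\<gamma> s)" using obtain_chart[OF s] .
    interpret curve_chart M c I \<gamma> by (rule curve_chart[OF c])
    have sT: "s \<in> T" by (rule in_T[OF s c])
    show "((\<lambda>s. w (\<gamma> s)) has_real_derivative a' s) (at s within I)"
      using w_along_derivative[OF w sT] a'_eq[OF s c] by simp
    have "dw_vel w r = a' r" if "r \<in> T" for r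
      using a'_eq[OF T_in(1,2)[OF that]] by simp
    then show "(a' has_real_derivative - f (w (\<gamma> s))) (at s within I)"
      unfolding has_real_derivative_iff_has_vector_derivative
      by (rule has_vector_derivative_cong_openin[OF openin_T sT, of "dw_vel w"])
        (use dw_vel_derivative[OF ob unit sT] in \<open>simp_all add: has_real_derivative_iff_has_vector_derivative\<close>)
  qed
  have a0: "a' 0 = u' 0"
  proof -
    obtain c where c: "c \<in> charts_at M (\<gamma> 0)" using obtain_chart[OF zero] .
    interpret curve_chart M c I \<gamma> by (rule curve_chart[OF c])
    show ?thesis
      using critical_point_iff[OF M w c] crit init
      by (simp add: a'_eq[OF zero c] dw_vel_def \<xi>_def)
  qed
  have "(\<lambda>s. w (\<gamma> s)) ` I \<subseteq> J" using J(2) \<gamma>_in by blast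
  note eq = second_order_ode_unique[OF J(1) f interval_I zero da da' this u(2,3,1) init(1)[symmetric] a0 t]
  show "w (\<gamma> t) = u t" by (rule eq(1))
  show "curve_chart.dw_vel M c I \<gamma> w t = u' t" if "c \<in> charts_at M (\<gamma> t)"
    using eq(2) a'_eq[OF t that] by simp
qed

text \<open>The difference \<open>E = W - u' \<gamma>'\<close> is parallel along \<open>\<gamma>\<close> and vanishes at \<open>0\<close>. Its vanishing at a
  point is independent of the chart, so it propagates through all charts met by the curve.\<close>

lemma gradient_along:
  assumes "t \<in> I" "c \<in> charts_at M (\<gamma> t)"
  shows "gradient_coeff M c (w \<circ> chart_inv c) i (snd c (\<gamma> t)) = u' t * velocity M I \<gamma> t c $ i"
proof -
  define E where "E c t = (\<chi> i. gradient_coeff M c (w \<circ> chart_inv c) i (snd c (\<gamma> t))) - u' t *\<^sub>R velocity M I \<gamma> t c" for c t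
  have E0_iff: "E c t = 0 \<longleftrightarrow> (\<forall>i. gradient_coeff M c (w \<circ> chart_inv c) i (snd c (\<gamma> t)) = u' t * velocity M I \<gamma> t c $ i)" for c t
    by (simp add: E_def vec_eq_iff)
  have change: "E d t = 0" if "t \<in> I" "c \<in> charts_at M (\<gamma> t)" "d \<in> charts_at M (\<gamma> t)" "E c t = 0" for c d t
    using gradient_proportional_change_chart[OF R w that(2,3) velocity_in_tangent_space[OF R proper geo that(1)]] that(4)
    unfolding E0_iff by blast
  have "\<forall>c\<in>charts_at M (\<gamma> t). E c t = 0"
  proof (rule connected_induction_simple[of I 0 t])
    show "connected I" using interval_I by (simp add: is_interval_connected)
    show "\<forall>c\<in>charts_at M (\<gamma> 0). E c 0 = 0"
      using critical_point_iff[OF M w] crit init by (auto simp: E0_iff gradient_coeff_def)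
  next
    fix t assume t: "t \<in> I"
    obtain c where c: "c \<in> charts_at M (\<gamma> t)" using obtain_chart[OF t] .
    interpret curve_chart M c I \<gamma> by (rule curve_chart[OF c])
    let ?W = "gradient_coeff M c (w \<circ> chart_inv c)"
    have tT: "t \<in> T" by (rule in_T[OF t c])
    have dE: "(E c has_vector_derivative - (A s *v E c s)) (at s within I)" if s: "s \<in> T" for s
    proof -
      have "((\<lambda>r. u' r *\<^sub>R vel r) has_vector_derivative (u' s *\<^sub>R (- (A s *v vel s)) + (- f (u s)) *\<^sub>R vel s)) (at s within I)"
        using has_vector_derivative_scaleR[OF u(3)[OF T_in(1)[OF s]] vel_derivative[OF s]] .
      moreover have "((\<lambda>r. \<chi> i. ?W i (\<xi> r)) has_vector_derivative
          (\<chi> i. - (A s *v (\<chi> i. ?W i (\<xi> s))) $ i - f (u s) * vel s $ i)) (at s within I)"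
        unfolding has_vector_derivative_def has_derivative_componentwise_within[of "\<lambda>r. \<chi> i. ?W i (\<xi> r)"]
      proof
        fix e :: "real ^ 'n" assume "e \<in> Basis"
        then obtain i where e: "e = axis i 1" by (auto simp: Basis_vec_def)
        have Wd: "?W i differentiable (at (\<xi> s))"
          by (rule differentiable_gradient[OF smooth_coordinate_function[OF w] hessian_obata[OF ob] T_in(3)[OF s]])
        have pW: "pderiv_at j (?W i) (\<xi> s) = - (\<Sum>l\<in>UNIV. \<Gamma> i j l (\<xi> s) * ?W l (\<xi> s)) - (if i = j then f (u s) else 0)" for j
          using pderiv_gradient[OF smooth_coordinate_function[OF w] hessian_obata[OF ob] T_in(3)[OF s], of j i]
            T_in(4)[OF s] w_along(1)[OF T_in(1)[OF s]] by simp
        have "(\<Sum>j\<in>UNIV. vel s $ j * pderiv_at j (?W i) (\<xi> s)) =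
           (\<Sum>j\<in>UNIV. - (\<Sum>l\<in>UNIV. \<Gamma> i j l (\<xi> s) * vel s $ j * ?W l (\<xi> s)) - (if i = j then f (u s) * vel s $ j else 0))"
          unfolding pW by (intro sum.cong refl) (simp add: algebra_simps sum_distrib_left)
        also have "\<dots> = - (\<Sum>j\<in>UNIV. \<Sum>l\<in>UNIV. \<Gamma> i j l (\<xi> s) * vel s $ j * ?W l (\<xi> s)) - f (u s) * vel s $ i"
          by (simp add: sum_subtractf sum_negf)
        also have "(\<Sum>j\<in>UNIV. \<Sum>l\<in>UNIV. \<Gamma> i j l (\<xi> s) * vel s $ j * ?W l (\<xi> s)) = (A s *v (\<chi> i. ?W i (\<xi> s))) $ i"
          unfolding connection_mult_nth by (subst sum.swap) simp
        finally have dW: "(\<Sum>j\<in>UNIV. vel s $ j * pderiv_at j (?W i) (\<xi> s)) =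
            - (A s *v (\<chi> i. ?W i (\<xi> s))) $ i - f (u s) * vel s $ i" .
        have "((\<lambda>r. ?W i (\<xi> r)) has_derivative
            (\<lambda>r. r * (- (A s *v (\<chi> i. ?W i (\<xi> s))) $ i - f (u s) * vel s $ i))) (at s within I)"
          using has_vector_derivative_chain_pderiv[OF \<xi>_derivative[OF s] Wd]
          unfolding dW has_field_derivative_def
          by (rule has_derivative_eq_rhs) (simp add: fun_eq_iff mult.commute)
        then show "((\<lambda>r. (\<chi> i. ?W i (\<xi> r)) \<bullet> e) has_derivative (\<lambda>r. (r *\<^sub>R (\<chi> i. - (A s *v (\<chi> i. ?W i (\<xi> s))) $ i - f (u s) * vel s $ i)) \<bullet> e)) (at s within I)"
          by (simp add: e inner_axis)
      qed
      ultimately have "((\<lambda>r. (\<chi> i. ?W i (\<xi> r)) - u' r *\<^sub>R vel r) has_vector_derivative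
          (\<chi> i. - (A s *v (\<chi> i. ?W i (\<xi> s))) $ i - f (u s) * vel s $ i) - (u' s *\<^sub>R (- (A s *v vel s)) + (- f (u s)) *\<^sub>R vel s)) (at s within I)"
        by (intro has_vector_derivative_diff)
      moreover have "(\<chi> i. - (A s *v (\<chi> i. ?W i (\<xi> s))) $ i - f (u s) * vel s $ i) - (u' s *\<^sub>R (- (A s *v vel s)) + (- f (u s)) *\<^sub>R vel s)
          = - (A s *v E c s)"
        by (simp add: vec_eq_iff E_def \<xi>_def vel_def matrix_vector_mult_diff_distrib matrix_vector_mult_scaleR)
      ultimately show ?thesis by (simp add: E_def[abs_def] \<xi>_def vel_def)
    qed
    have "\<exists>N. openin (top_of_set I) N \<and> t \<in> N \<and> N \<subseteq> T \<and> (\<forall>a\<in>N. \<forall>b\<in>N. E c a = 0 \<longrightarrow> E c b = 0)"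
    proof (rule zero_propagates_locally[OF interval_I t openin_T tT])
      show "continuous_on T (E c)"
        using dE has_vector_derivative_continuous continuous_within_subset[OF _ openin_imp_subset[OF openin_T]]
        unfolding continuous_on_eq_continuous_within by blast
      show "norm (- (A s *v E c s)) \<le> Abound s * norm (E c s)" for s
        using norm_A_le by simp
      show "continuous (at t within I) Abound" by (rule continuous_Abound[OF tT])
    qed (rule dE)
    then obtain N where N: "openin (top_of_set I) N" "t \<in> N" "N \<subseteq> T" "\<And>a b. a \<in> N \<Longrightarrow> b \<in> N \<Longrightarrow> E c a = 0 \<Longrightarrow> E c b = 0"
      by blast
    have "\<forall>d\<in>charts_at M (\<gamma> b). E d b = 0" if "a \<in> N" "b \<in> N" "\<forall>c\<in>charts_at M (\<gamma> a). E c a = 0" for a b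
    proof -
      have "E c a = 0" using that N(3) T_in(2)[of a] by blast
      then have "E c b = 0" by (rule N(4)[OF that(1,2)])
      then show ?thesis using change[of b c] T_in(1,2)[of b] N(3) that(2) by blast
    qed
    with N(1,2) show "\<exists>T. openin (top_of_set I) T \<and> t \<in> T \<and> (\<forall>x\<in>T. \<forall>y\<in>T.
        (\<forall>c\<in>charts_at M (\<gamma> x). E c x = 0) \<longrightarrow> (\<forall>c\<in>charts_at M (\<gamma> y). E c y = 0))" by blast
  qed (use zero assms in auto)
  then show ?thesis using assms(2) E0_iff by blast
qed

text \<open>The identity of \<open>curvature_gradient\<close> with \<open>W = u' \<gamma>'\<close>, \<open>dw(\<gamma>') = u'\<close> and
  \<open>dw(X) = u' g(X, \<gamma>') = 0\<close>, divided by \<open>u'\<close>.\<close>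

lemma curvature_along:
  assumes t: "t \<in> I" and c: "c \<in> charts_at M (\<gamma> t)"
    and X: "X \<in> tangent_space M (\<gamma> t)" and perp: "metric M (\<gamma> t) X (velocity M I \<gamma> t) = 0"
    and nz: "u' t \<noteq> 0"
  shows "curvature M (\<gamma> t) X (velocity M I \<gamma> t) (velocity M I \<gamma> t) c = f' (u t) *\<^sub>R X c"
proof -
  interpret curve_chart M c I \<gamma> by (rule curve_chart[OF c])
  have tT: "t \<in> T" by (rule in_T[OF t c])
  define h where "h = w \<circ> chart_inv c"
  define F where "F x = f (h x)" for x
  note smooth = smooth_coordinate_function[OF w, folded h_def]
  have hess: "pderiv_at i (pderiv_at j h) x = (\<Sum>k\<in>UNIV. \<Gamma> k i j x * pderiv_at k h x) - F x * g i j x" if "x \<in> U" for x i j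
    unfolding h_def F_def by (rule hessian_obata[OF ob that])
  have hU: "h ` U \<subseteq> J"
    using chart_inv_simps(3)[OF smooth_mfd chart] atlas_props(4)[OF smooth_mfd chart] J(2)
    by (auto simp: h_def image_subset_iff)
  have dF: "F differentiable (at x)" and pF: "pderiv_at i F x = f' (h x) * pderiv_at i h x" if x: "x \<in> U" for x i
  proof -
    have hx: "h x \<in> J" using hU x by blast
    from pderiv_at_compose_real[OF f(1)[OF hx] open_U x hU smooth_on_imp_differentiable[OF smooth x]]
    show "F differentiable (at x)" "pderiv_at i F x = f' (h x) * pderiv_at i h x" by (simp_all add: F_def[abs_def])
  qed
  have hu: "h (\<xi> t) = u t" using T_in(4)[OF tT] w_along(1)[OF t] by (simp add: h_def)
  have W: "gradient_coeff M c h k (\<xi> t) = u' t * vel t $ k" for k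
    using gradient_along[OF t c] by (simp add: h_def \<xi>_def vel_def)
  have V: "velocity M I \<gamma> t \<in> tangent_space M (\<gamma> t)"
    by (rule velocity_in_tangent_space[OF R proper geo t])
  have dhX: "(\<Sum>i\<in>UNIV. pderiv_at i h (\<xi> t) * X c $ i) = 0"
  proof -
    have "(\<Sum>i\<in>UNIV. pderiv_at i h (\<xi> t) * X c $ i) = u' t * (\<Sum>i\<in>UNIV. \<Sum>j\<in>UNIV. g i j (\<xi> t) * X c $ i * vel t $ j)"
      by (simp add: lower_gradient[OF T_in(3)[OF tT], symmetric] W sum_distrib_left sum_distrib_right mult_ac)
    also have "\<dots> = 0"
      using perp unfolding metric_in_chart[OF R c X V] by (simp add: \<xi>_def vel_def)
    finally show ?thesis .
  qed
  have dhv: "(\<Sum>j\<in>UNIV. pderiv_at j h (\<xi> t) * vel t $ j) = u' t"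
    using w_along(2)[OF t c] by (simp add: dw_vel_def h_def mult.commute)
  have "u' t * curvature M (\<gamma> t) X (velocity M I \<gamma> t) (velocity M I \<gamma> t) c $ l = u' t * (f' (u t) * X c $ l)" for l
  proof -
    have "u' t * curvature M (\<gamma> t) X (velocity M I \<gamma> t) (velocity M I \<gamma> t) c $ l =
      (\<Sum>i\<in>UNIV. \<Sum>j\<in>UNIV. (\<Sum>k\<in>UNIV. curvature_coeff M c l k i j (\<xi> t) * gradient_coeff M c h k (\<xi> t)) * X c $ i * vel t $ j)"
      using c by (simp add: curvature_def W[unfolded \<xi>_def vel_def] \<xi>_def vel_def sum_distrib_left sum_distrib_right mult_ac)
    also have "\<dots> = (\<Sum>i\<in>UNIV. \<Sum>j\<in>UNIV. ((if l = i then pderiv_at j F (\<xi> t) else 0) - (if l = j then pderiv_at i F (\<xi> t) else 0)) * X c $ i * vel t $ j)"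
      by (simp only: curvature_gradient[OF smooth hess T_in(3)[OF tT] dF])
    also have "\<dots> = (\<Sum>i\<in>UNIV. \<Sum>j\<in>UNIV. if l = i then pderiv_at j F (\<xi> t) * X c $ i * vel t $ j else 0)
        - (\<Sum>i\<in>UNIV. \<Sum>j\<in>UNIV. if l = j then pderiv_at i F (\<xi> t) * X c $ i * vel t $ j else 0)"
      unfolding sum_subtractf[symmetric] by (intro sum.cong refl) (simp add: left_diff_distrib)
    also have "(\<Sum>i\<in>UNIV. \<Sum>j\<in>UNIV. if l = i then pderiv_at j F (\<xi> t) * X c $ i * vel t $ j else 0)
        = X c $ l * (\<Sum>j\<in>UNIV. pderiv_at j F (\<xi> t) * vel t $ j)"
      by (subst sum.swap) (simp add: sum_distrib_left mult_ac)
    also have "(\<Sum>i\<in>UNIV. \<Sum>j\<in>UNIV. if l = j then pderiv_at i F (\<xi> t) * X c $ i * vel t $ j else 0)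
        = (\<Sum>i\<in>UNIV. pderiv_at i F (\<xi> t) * X c $ i) * vel t $ l"
      by (simp add: sum_distrib_right)
    also have "(\<Sum>i\<in>UNIV. pderiv_at i F (\<xi> t) * X c $ i) = f' (u t) * (\<Sum>i\<in>UNIV. pderiv_at i h (\<xi> t) * X c $ i)"
      by (simp add: pF[OF T_in(3)[OF tT]] hu sum_distrib_left mult_ac)
    also have "(\<Sum>j\<in>UNIV. pderiv_at j F (\<xi> t) * vel t $ j) = f' (u t) * (\<Sum>j\<in>UNIV. pderiv_at j h (\<xi> t) * vel t $ j)"
      by (simp add: pF[OF T_in(3)[OF tT]] hu sum_distrib_left mult_ac)
    finally show ?thesis unfolding dhX dhv by (simp add: mult_ac)
  qed
  then show ?thesis using nz by (simp add: vec_eq_iff)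
qed

end

section \<open>Normal Jacobi fields\<close>

lemma has_nonzero_derivative_imp_locally_nonzero:
  fixes v :: "real \<Rightarrow> real"
  assumes d: "(v has_real_derivative d) (at t within I)" and nz: "v t \<noteq> 0 \<or> d \<noteq> 0" and t: "t \<in> I"
  obtains N where "openin (top_of_set I) N" "t \<in> N" "\<And>s. s \<in> N \<Longrightarrow> s \<noteq> t \<Longrightarrow> v s \<noteq> 0"
proof -
  have "eventually (\<lambda>s. v s \<noteq> 0) (at t within I)"
  proof (cases "v t = 0")
    case False
    have "(v \<longlongrightarrow> v t) (at t within I)"
      using DERIV_continuous[OF d] by (simp add: continuous_within)
    then show ?thesis using False tendsto_imp_eventually_ne by blast
  next
    case True
    then have "((\<lambda>s. (v s - v t) / (s - t)) \<longlongrightarrow> d) (at t within I)" and "d \<noteq> 0"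
      using d nz unfolding has_field_derivative_iff by auto
    then have "eventually (\<lambda>s. (v s - v t) / (s - t) \<noteq> 0) (at t within I)"
      using tendsto_imp_eventually_ne by blast
    then show ?thesis by (rule eventually_mono) (auto simp: True)
  qed
  then obtain e where e: "e > 0" "\<And>s. s \<in> I \<Longrightarrow> s \<noteq> t \<Longrightarrow> dist s t < e \<Longrightarrow> v s \<noteq> 0"
    unfolding eventually_at by blast
  show ?thesis
  proof (rule that[of "I \<inter> ball t e"])
    show "openin (top_of_set I) (I \<inter> ball t e)" by (simp add: openin_open_Int)
    show "t \<in> I \<inter> ball t e" using t e(1) by simp
    show "v s \<noteq> 0" if "s \<in> I \<inter> ball t e" "s \<noteq> t" for s
      using e(2)[of s] that by (simp add: dist_commute)
  qed
qed

lemma (in curve_chart) field_along_differentiable: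
  assumes "field_along M I \<gamma> X" "t \<in> T"
  shows "(\<lambda>s. X s c) differentiable (at t within I)"
proof -
  have "smooth_within I T (\<lambda>s. X s c)"
    using assms(1) chart unfolding field_along_def T_def by blast
  then show ?thesis
    unfolding smooth_within_def using assms(2) iter_deriv.simps(1) by metis
qed

lemma (in curve_chart) cov_deriv_differentiable:
  assumes X: "field_along M I \<gamma> X" and t: "t \<in> T"
  shows "(\<lambda>s. cov_deriv M I \<gamma> X s c) differentiable (at t within I)"
proof -
  have "smooth_within I T (\<lambda>s. X s c)"
    using X chart unfolding field_along_def T_def by blast
  then have 1: "iter_deriv I 1 (\<lambda>s. X s c) differentiable (at t within I)"
    unfolding smooth_within_def using t by blast
  have 2: "(\<lambda>s. A s *v X s c) differentiable (at t within I)"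
  proof (rule differentiable_vec_componentwise)
    fix i
    have "(\<lambda>s. A s $ i $ j) differentiable (at t within I)" "(\<lambda>s. X s c $ j) differentiable (at t within I)" for j
      by (intro differentiable_vec_nth differentiable_connection field_along_differentiable X t)+
    then show "(\<lambda>s. (A s *v X s c) $ i) differentiable (at t within I)"
      unfolding matrix_vector_mult_def by (simp add: differentiable_sum_fun)
  qed
  define G where "G s = iter_deriv I 1 (\<lambda>s. X s c) s + A s *v X s c" for s
  have "G differentiable (at t within I)"
    unfolding G_def[abs_def] using 1 2 by (intro differentiable_add)
  then have dG: "(G has_vector_derivative vector_derivative G (at t within I)) (at t within I)"
    by (simp add: vector_derivative_works)
  have G: "G s = cov_deriv M I \<gamma> X s c" if "s \<in> T" for s
    using cov_deriv_eq_connection_matrix[where \<gamma> = \<gamma> and t = s and X = X and I = I, OF T_in(2)[OF that]] by (simp add: G_def)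
  from has_vector_derivative_cong_openin[OF openin_T t G dG]
  show ?thesis by (auto simp: differentiable_def has_vector_derivative_def)
qed

text \<open>Otherwise the constant \<open>u t\<close> solves the same initial value problem at \<open>t\<close> as \<open>u\<close>, and then
  \<open>f(u 0) = f(u t) = 0\<close>.\<close>

lemma (in obata_geodesic) nondegenerate_along:
  assumes t: "t \<in> I" shows "u' t \<noteq> 0 \<or> f (u t) \<noteq> 0"
proof (rule ccontr)
  assume "\<not> (u' t \<noteq> 0 \<or> f (u t) \<noteq> 0)"
  then have 0: "u' t = 0" "f (u t) = 0" by auto
  have utJ: "u t \<in> J" using u(1) t by auto
  have "u 0 = u t"
    by (rule second_order_ode_unique(1)[OF J(1) f interval_I t u(2,3,1), where b = "\<lambda>_. u t" and b' = "\<lambda>_. 0"])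
      (use 0 utJ zero in auto)
  then show False using 0 nondeg init by simp
qed

text \<open>With \<open>\<phi> = - u' / f(\<mu>)\<close>, so that \<open>\<phi>'' = - f'(u) \<phi>\<close>, the differences \<open>D = Y - \<phi> V\<close> and
  \<open>E = Y' - \<phi>' V\<close> satisfy, in a chart and up to connection terms, \<open>D' = E\<close> and \<open>E' = - f'(u) D\<close>, the
  latter away from the isolated zeros of \<open>u'\<close>.\<close>

lemma (in obata_geodesic) normal_jacobi_field:
  assumes Y: "jacobi_field M I \<gamma> Y" "normal_along M I \<gamma> Y" "Y 0 = (\<lambda>_. 0)"
    and V: "parallel_along M I \<gamma> V" "V 0 = cov_deriv M I \<gamma> Y 0" and t: "t \<in> I"
  shows "Y t = (\<lambda>c. (- inverse (f (u 0)) * u' t) *\<^sub>R V t c)"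
proof -
  define \<phi> where "\<phi> s = - inverse (f (u 0)) * u' s" for s
  define \<phi>' where "\<phi>' s = inverse (f (u 0)) * f (u s)" for s
  have f0: "f (u 0) \<noteq> 0" using nondeg init by simp
  have fY: "field_along M I \<gamma> Y" and fV: "field_along M I \<gamma> V"
    using Y(1) V(1) by (auto simp: jacobi_field_def parallel_along_def)
  have YT: "Y s \<in> tangent_space M (\<gamma> s)" and VT: "V s \<in> tangent_space M (\<gamma> s)" if "s \<in> I" for s
    using fY fV that by (auto simp: field_along_def)
  have d\<phi>: "(\<phi> has_real_derivative \<phi>' s) (at s within I)" if "s \<in> I" for s
    unfolding \<phi>_def[abs_def] \<phi>'_def using DERIV_cmult[OF u(3)[OF that], of "- inverse (f (u 0))"] by simp
  have d\<phi>': "(\<phi>' has_real_derivative - f' (u s) * \<phi> s) (at s within I)" if s: "s \<in> I" for s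
  proof -
    have "u s \<in> J" using u(1) s by auto
    from DERIV_subset[OF f(1)[OF this] u(1)]
    have "((f \<circ> u) has_real_derivative f' (u s) * u' s) (at s within I)"
      using DERIV_image_chain[of f "f' (u s)" u s I "u' s"] u(2)[OF s] by blast
    from DERIV_cmult[OF this, of "inverse (f (u 0))"] show ?thesis
      by (simp add: \<phi>_def \<phi>'_def[abs_def] o_def mult_ac)
  qed
  define Z where "Z c s = (Y s c - \<phi> s *\<^sub>R V s c, cov_deriv M I \<gamma> Y s c - \<phi>' s *\<^sub>R V s c)" for c s
  \<comment> \<open>The property to propagate is \<open>Y = \<phi> V\<close> near \<open>t\<close>, not \<open>Z = 0\<close> at \<open>t\<close>: it does not mention a chart
    and contains the vanishing of \<open>E\<close>, so it carries over from one chart to the next.\<close>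
  let ?P = "\<lambda>t. \<exists>N. openin (top_of_set I) N \<and> t \<in> N \<and> (\<forall>s\<in>N. \<forall>c. Y s c = \<phi> s *\<^sub>R V s c)"
  have local: "\<exists>N. openin (top_of_set I) N \<and> t \<in> N \<and>
      ((\<exists>a\<in>N. Z c a = 0) \<longrightarrow> (\<forall>s\<in>N. \<forall>d. Y s d = \<phi> s *\<^sub>R V s d)) \<and> (\<forall>a\<in>N. ?P a \<longrightarrow> Z c a = 0)"
    if t: "t \<in> I" and c: "c \<in> charts_at M (\<gamma> t)" for t c
  proof -
    interpret curve_chart M c I \<gamma> by (rule curve_chart[OF c])
    have tT: "t \<in> T" by (rule in_T[OF t c])
    have "u' t \<noteq> 0 \<or> - f (u t) \<noteq> 0" using nondegenerate_along[OF t] by simp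
    from has_nonzero_derivative_imp_locally_nonzero[OF u(3)[OF t] this t]
    obtain N0 where N0: "openin (top_of_set I) N0" "t \<in> N0" "\<And>s. s \<in> N0 \<Longrightarrow> s \<noteq> t \<Longrightarrow> u' s \<noteq> 0"
      by blast
    define S where "S = T \<inter> N0"
    have S: "openin (top_of_set I) S" "t \<in> S" using openin_Int[OF openin_T N0(1)] tT N0(2) by (auto simp: S_def)
    have ST: "S \<subseteq> T" by (auto simp: S_def)
    let ?DY = "cov_deriv M I \<gamma> Y"
    have dY: "((\<lambda>s. Y s c) has_vector_derivative ?DY s c - A s *v Y s c) (at s within I)" if "s \<in> T" for s
      by (rule field_derivative[where X = Y, OF that field_along_differentiable[OF fY that]])
    have dV: "((\<lambda>s. V s c) has_vector_derivative - (A s *v V s c)) (at s within I)" if "s \<in> T" for s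
      using field_derivative[where X = V, OF that field_along_differentiable[OF fV that]] V(1) T_in(1)[OF that]
      by (simp add: parallel_along_def)
    have dDY: "((\<lambda>s. ?DY s c) has_vector_derivative
        - curvature M (\<gamma> s) (Y s) (velocity M I \<gamma> s) (velocity M I \<gamma> s) c - A s *v ?DY s c) (at s within I)"
      if "s \<in> T" for s
    proof -
      have "cov_deriv M I \<gamma> ?DY s c + curvature M (\<gamma> s) (Y s) (velocity M I \<gamma> s) (velocity M I \<gamma> s) c = 0"
        using Y(1) T_in(1)[OF that] unfolding jacobi_field_def by blast
      then have "cov_deriv M I \<gamma> ?DY s c = - curvature M (\<gamma> s) (Y s) (velocity M I \<gamma> s) (velocity M I \<gamma> s) c"
        by (simp add: eq_neg_iff_add_eq_0)
      then show ?thesis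
        using field_derivative[OF that, of ?DY] cov_deriv_differentiable[OF fY that] by simp
    qed
    have sc: "((\<lambda>s. \<psi> s *\<^sub>R V s c) has_vector_derivative (\<psi> s *\<^sub>R (- (A s *v V s c)) + d *\<^sub>R V s c)) (at s within I)"
      if "s \<in> T" "(\<psi> has_real_derivative d) (at s within I)" for \<psi> d s
      using has_vector_derivative_scaleR[OF that(2) dV[OF that(1)]] .
    define D where "D s = Y s c - \<phi> s *\<^sub>R V s c" for s
    define E where "E s = ?DY s c - \<phi>' s *\<^sub>R V s c" for s
    have Z: "Z c s = (D s, E s)" for s by (simp add: Z_def D_def E_def)
    have dD: "(D has_vector_derivative E s - A s *v D s) (at s within I)" if s: "s \<in> T" for s
      unfolding D_def[abs_def]
      using has_vector_derivative_diff[OF dY[OF s] sc[OF s d\<phi>[OF T_in(1)[OF s]]]]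
      by (simp add: E_def D_def matrix_vector_mult_diff_distrib matrix_vector_mult_scaleR algebra_simps)
    have dE_gen: "(E has_vector_derivative - curvature M (\<gamma> s) (Y s) (velocity M I \<gamma> s) (velocity M I \<gamma> s) c
        + (f' (u s) * \<phi> s) *\<^sub>R V s c - A s *v E s) (at s within I)" if s: "s \<in> T" for s
      unfolding E_def[abs_def]
      using has_vector_derivative_diff[OF dDY[OF s] sc[OF s d\<phi>'[OF T_in(1)[OF s]]]]
      by (simp add: E_def matrix_vector_mult_diff_distrib matrix_vector_mult_scaleR algebra_simps)
    have dE: "(E has_vector_derivative - f' (u s) *\<^sub>R D s - A s *v E s) (at s within I)" if s: "s \<in> S" "s \<noteq> t" for s
    proof -
      have sT: "s \<in> T" and nz: "u' s \<noteq> 0" using s N0(3) by (auto simp: S_def)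
      have "metric M (\<gamma> s) (Y s) (velocity M I \<gamma> s) = 0"
        using Y(2) T_in(1)[OF sT] by (simp add: normal_along_def)
      note cur = curvature_along[OF T_in(1,2)[OF sT] YT[OF T_in(1)[OF sT]] this nz]
      show ?thesis using dE_gen[OF sT] unfolding cur by (simp add: D_def algebra_simps)
    qed
    have "\<exists>N. openin (top_of_set I) N \<and> t \<in> N \<and> N \<subseteq> S \<and> (\<forall>a\<in>N. \<forall>b\<in>N. Z c a = 0 \<longrightarrow> Z c b = 0)"
    proof (rule zero_propagates_locally[OF interval_I t S, where K = "\<lambda>s. 1 + 2 * Abound s + \<bar>f' (u s)\<bar>"])
      have "continuous (at s within I) D" "continuous (at s within I) E" if "s \<in> S" for s
        using dD dE_gen ST that has_vector_derivative_continuous by blast+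
      then have "continuous (at s within S) (Z c)" if "s \<in> S" for s
        unfolding Z using that continuous_within_subset[OF _ openin_imp_subset[OF S(1)]]
        by (intro continuous_Pair) blast+
      then show "continuous_on S (Z c)" unfolding continuous_on_eq_continuous_within by blast
    next
      fix s assume s: "s \<in> S" "s \<noteq> t"
      then have sT: "s \<in> T" using ST by blast
      show "(Z c has_vector_derivative (E s - A s *v D s, - f' (u s) *\<^sub>R D s - A s *v E s)) (at s within I)"
        unfolding Z[abs_def] by (rule has_vector_derivative_Pair[OF dD[OF sT] dE[OF s]])
      have DE: "norm (D s) \<le> norm (Z c s)" "norm (E s) \<le> norm (Z c s)"
        unfolding Z by (rule norm_fst_le, rule norm_snd_le)
      have A0: "Abound s \<ge> 0" unfolding Abound_def by (intro sum_nonneg) auto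
      have "norm (E s - A s *v D s) \<le> norm (Z c s) + Abound s * norm (Z c s)"
        using norm_triangle_ineq4[of "E s" "A s *v D s"] norm_A_le[of s "D s"] DE mult_left_mono[OF DE(1) A0] by linarith
      moreover have "norm (- f' (u s) *\<^sub>R D s - A s *v E s) \<le> \<bar>f' (u s)\<bar> * norm (Z c s) + Abound s * norm (Z c s)"
        using norm_triangle_ineq4[of "- f' (u s) *\<^sub>R D s" "A s *v E s"] norm_A_le[of s "E s"]
          mult_left_mono[OF DE(1), of "\<bar>f' (u s)\<bar>"] mult_left_mono[OF DE(2) A0] by simp
      ultimately show "norm (E s - A s *v D s, - f' (u s) *\<^sub>R D s - A s *v E s) \<le> (1 + 2 * Abound s + \<bar>f' (u s)\<bar>) * norm (Z c s)"
        using norm_Pair_le[of "E s - A s *v D s" "- f' (u s) *\<^sub>R D s - A s *v E s"] by (simp add: algebra_simps)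
    next
      have "continuous_on I u" using u(2) DERIV_continuous_on by blast
      then have "continuous_on I (\<lambda>s. f' (u s))" using continuous_on_compose2[OF f(2) _ u(1)] by blast
      then have "continuous (at t within I) (\<lambda>s. f' (u s))" using t by (simp add: continuous_on_eq_continuous_within)
      then show "continuous (at t within I) (\<lambda>s. 1 + 2 * Abound s + \<bar>f' (u s)\<bar>)"
        using continuous_Abound[OF tT] by (intro continuous_intros)
    qed
    then obtain N where N: "openin (top_of_set I) N" "t \<in> N" "N \<subseteq> S" "\<And>a b. a \<in> N \<Longrightarrow> b \<in> N \<Longrightarrow> Z c a = 0 \<Longrightarrow> Z c b = 0"
      by blast
    have vanish: "Y s d = \<phi> s *\<^sub>R V s d" if "a \<in> N" "Z c a = 0" "s \<in> N" for a s d
    proof -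
      have sT: "s \<in> T" using that N(3) ST by blast
      have "Z c s = 0" by (rule N(4)[OF that(1,3,2)])
      then have Dc: "Y s c = \<phi> s *\<^sub>R V s c + 0 *\<^sub>R V s c" by (simp add: Z D_def zero_prod_def)
      note tv = tvec_of_tangent_vector[OF _ T_in(2)[OF sT]]
      have "tvec_of M c (\<gamma> s) (Y s c) d = \<phi> s *\<^sub>R tvec_of M c (\<gamma> s) (V s c) d + 0 *\<^sub>R tvec_of M c (\<gamma> s) (V s c) d"
        unfolding Dc tvec_of_add_scaleR[OF M T_in(2)[OF sT]] ..
      then show ?thesis
        unfolding tv[OF YT[OF T_in(1)[OF sT]]] tv[OF VT[OF T_in(1)[OF sT]]] by simp
    qed
    have init: "Z c a = 0" if a: "a \<in> N" and "?P a" for a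
    proof -
      have aT: "a \<in> T" using a N(3) ST by blast
      from \<open>?P a\<close> obtain N1 where N1: "openin (top_of_set I) N1" "a \<in> N1" and
        eq: "\<forall>s\<in>N1. \<forall>d. Y s d = \<phi> s *\<^sub>R V s d" by blast
      have D0: "D s = 0" if "s \<in> N1" for s using eq that unfolding D_def by (metis diff_self)
      have "(D has_vector_derivative 0) (at a within I)"
        by (rule has_vector_derivative_cong_openin[OF N1(1,2), of "\<lambda>_. 0"]) (simp_all add: D0)
      from vector_derivative_unique_within[OF proper_interval_not_bot[OF proper T_in(1)[OF aT]] dD[OF aT] this]
      show ?thesis using D0[OF N1(2)] by (simp add: Z zero_prod_def)
    qed
    show ?thesis
    proof (intro exI[of _ N] conjI impI ballI allI)
      show "openin (top_of_set I) N" "t \<in> N" by fact+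
      show "Y s d = \<phi> s *\<^sub>R V s d" if "\<exists>a\<in>N. Z c a = 0" "s \<in> N" for s d
        using that(1) vanish[OF _ _ that(2)] by (elim bexE)
      show "Z c a = 0" if "a \<in> N" "?P a" for a
        by (rule init[OF that])
    qed
  qed
  have "?P t"
  proof (rule connected_induction_simple[of I 0 t ?P])
    show "connected I" using interval_I by (simp add: is_interval_connected)
    obtain c where c: "c \<in> charts_at M (\<gamma> 0)" using obtain_chart[OF zero] .
    have "Z c 0 = 0" using Y(3) V(2) init f0 by (simp add: Z_def \<phi>_def \<phi>'_def zero_prod_def)
    with local[OF zero c] show "?P 0" by blast
  next
    fix t assume t: "t \<in> I"
    obtain c where c: "c \<in> charts_at M (\<gamma> t)" using obtain_chart[OF t] .
    from local[OF t c] obtain N where N: "openin (top_of_set I) N" "t \<in> N"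
      "(\<exists>a\<in>N. Z c a = 0) \<longrightarrow> (\<forall>s\<in>N. \<forall>d. Y s d = \<phi> s *\<^sub>R V s d)" "\<forall>a\<in>N. ?P a \<longrightarrow> Z c a = 0" by blast
    then have "\<forall>x\<in>N. \<forall>y\<in>N. ?P x \<longrightarrow> ?P y" by blast
    with N(1,2) show "\<exists>T. openin (top_of_set I) T \<and> t \<in> T \<and> (\<forall>x\<in>T. \<forall>y\<in>T. ?P x \<longrightarrow> ?P y)" by blast
  qed (use zero t in auto)
  then show ?thesis by (auto simp: \<phi>_def)
qed

theorem proposition1p6:
  fixes M :: "('m, 'n::finite) riem"
    and f u u' :: "real \<Rightarrow> real" and J I :: "real set"
    and w :: "'m \<Rightarrow> real" and p\<^sub>0 :: 'm and \<mu> :: real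
    and \<gamma> :: "real \<Rightarrow> 'm" and Y V :: "real \<Rightarrow> ('m, 'n) tvec"
  assumes "riemannian_manifold M" and "connected_space (top_of M)" and "complete_manifold M"
    and "proper_interval J" and "w ` pts M \<subseteq> J" and "smooth_within J J f"
    and "obata_solution M f w" and "\<not> (\<exists>k. \<forall>p\<in>pts M. w p = k)"
    and "critical_point M w p\<^sub>0" and "\<mu> = w p\<^sub>0"
    and "proper_interval I" and "0 \<in> I"
    and "geodesic M I \<gamma>" and "unit_speed M I \<gamma>" and "\<gamma> 0 = p\<^sub>0"
    and "u ` I \<subseteq> J"
    and "\<forall>t\<in>I. (u has_real_derivative u' t) (at t within I)"
    and "\<forall>t\<in>I. (u' has_real_derivative - f (u t)) (at t within I)"
    and "u 0 = \<mu>" and "u' 0 = 0"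
    and "jacobi_field M I \<gamma> Y" and "normal_along M I \<gamma> Y" and "Y 0 = (\<lambda>_. 0)"
    and "parallel_along M I \<gamma> V" and "V 0 = cov_deriv M I \<gamma> Y 0"
  shows "f \<mu> \<noteq> 0 \<and> (\<forall>t\<in>I. Y t = (\<lambda>c. (- inverse (f \<mu>) * u' t) *\<^sub>R V t c))"
proof -
  obtain f' where f': "\<And>s. s \<in> J \<Longrightarrow> (f has_real_derivative f' s) (at s within J)" "continuous_on J f'"
    using smooth_within_real_C1[OF \<open>smooth_within J J f\<close>] by blast
  have J: "is_interval J" using \<open>proper_interval J\<close> by (simp add: proper_interval_def)
  have f\<mu>: "f \<mu> \<noteq> 0"
    unfolding \<open>\<mu> = w p\<^sub>0\<close> using assms(1,2) J assms(5) f' assms(7-9) by (rule obata_critical_value_nondegenerate)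
  interpret obata_geodesic M f f' u u' J I w \<gamma>
    using assms J f' f\<mu> by unfold_locales auto
  show ?thesis
    using f\<mu> normal_jacobi_field[OF assms(21-25)] \<open>u 0 = \<mu>\<close> by simp
qed

end
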